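(* Fix an equation $(f,q,w)$ as in the context. For $a_{12},b_{21}\in\mathbb R$ and a fixed $z\in\mathbb C$ let $\mathbf A(a_{12},b_{21})$ be the self-adjoint boundary condition with coefficient matrix $\begin{pmatrix}1&a_{12}&\bar z&0\\0&z&b_{21}&1\end{pmatrix}$, and let $\mathbf S_1=\begin{pmatrix}0&1&0&0\\0&0&b_{21}&1\end{pmatrix}$, $\mathbf S_2=\begin{pmatrix}1&a_{12}&0&0\\0&0&1&0\end{pmatrix}$. Then the problem with $\mathbf A(a_{12},b_{21})$ has exactly $N$ eigenvalues if $a_{12}\ne1/f_0$ and exactly $N-1$ if $a_{12}=1/f_0$; with $\mathbf S_1$ it has exactly $N$ eigenvalues; with $\mathbf S_2$ it has exactly $N-1$ eigenvalues if $a_{12}\neq1/f_0$ and exactly $N-2$ if $a_{12}=1/f_0$. Further: (i) fix $b_{21}$ and let $a^{(1)}<a^{(2)}\le1/f_0<a^{(3)}<a^{(4)}$; writing $\lambda_n(a^{(i)})$ for the eigenvalues with $\mathbf A(a^{(i)},b_{21})$ and $\lambda_n(\mathbf S_1)$ for those with $\mathbf S_1$: for each $0\le n\le N-2$, $\lambda_n(a^{(3)})\le\lambda_n(a^{(4)})\le\lambda_n(\mathbf S_1)\le\lambda_n(a^{(1)})\le\lambda_n(a^{(2)})\le\lambda_{n+1}(a^{(3)})$, and $\lambda_{N-1}(a^{(3)})\le\lambda_{N-1}(a^{(4)})\le\lambda_{N-1}(\mathbf S_1)\le\lambda_{N-1}(a^{(1)})$; in addition $\lambda_{N-1}(a^{(1)})\le\lambda_{N-1}(a^{(2)})$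 if $a^{(2)}<1/f_0$; (ii) fix $a_{12}$ and let $b^{(1)}<b^{(2)}$; writing $\lambda_n(b^{(j)})$ for the eigenvalues with $\mathbf A(a_{12},b^{(j)})$ and $\lambda_n(\mathbf S_2)$ for those with $\mathbf S_2$: for each $0\le n\le N-3$, $\lambda_n(b^{(1)})\le\lambda_n(b^{(2)})\le\lambda_n(\mathbf S_2)\le\lambda_{n+1}(b^{(1)})$, and $\lambda_{N-2}(b^{(1)})\le\lambda_{N-2}(b^{(2)})$; in addition, if $a_{12}\neq1/f_0$, then $\lambda_{N-2}(b^{(2)})\le\lambda_{N-2}(\mathbf S_2)\le\lambda_{N-1}(b^{(1)})\le\lambda_{N-1}(b^{(2)})$.
   Context: Let $N\ge2$ be an integer. An equation is given by real sequences $f=\{f_n\}_{n=0}^N$, $q=\{q_n\}_{n=1}^N$, $w=\{w_n\}_{n=1}^N$ with $f_n\neq0$, $w_n>0$; it is $-\nabla(f_n\Delta y_n)+q_ny_n=\lambda w_ny_n$, $1\le n\le N$, for $y=\{y_n\}_{n=0}^{N+1}$, $\Delta y_n=y_{n+1}-y_n$, $\nabla y_n=y_n-y_{n-1}$. A boundary condition with $2\times4$ coefficient matrix $(A,B)$ (rank 2) is $A(y_0,f_0\Delta y_0)^T+B(y_N,f_N\Delta y_N)^T=0$; matrices differing by left multiplication by an invertible $2\times2$ complex matrix give the same condition. Eigenvalues ($\lambda$ with a nontrivial solution) of a self-adjoint problem are real; multiplicity = dimension of the solution space (equal to the multiplicity as a zero of the characteristic polynomial); counted with multiplicity they are ordered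 $\lambda_0\le\lambda_1\le\cdots$, and "exactly $k$ eigenvalues" counts multiplicity. *)

theory Defs
  imports "HOL-Analysis.Analysis" "HOL-Library.Function_Algebras"
begin

text \<open>Discrete Sturm--Liouville problem
  -nabla(f_n Delta y_n) + q_n y_n = lambda w_n y_n, 1 <= n <= N,
  with boundary condition A (y_0, f_0 Delta y_0)^T + B (y_N, f_N Delta y_N)^T = 0.
  A 2x4 coefficient matrix (A,B) is represented as a function M i j (i < 2, j < 4).
  Solutions y are sequences y_0, ..., y_{N+1}, represented as functions nat => complex
  that vanish beyond N+1.\<close>

definition sl_eq :: "(nat \<Rightarrow> real) \<Rightarrow> (nat \<Rightarrow> real) \<Rightarrow> (nat \<Rightarrow> real) \<Rightarrow> nat
    \<Rightarrow> complex \<Rightarrow> (nat \<Rightarrow> complex) \<Rightarrow> bool" where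
  "sl_eq f q w N lam y \<longleftrightarrow>
     (\<forall>n\<in>{1..N}.
        - (of_real (f n) * (y (n+1) - y n) - of_real (f (n-1)) * (y n - y (n-1)))
        + of_real (q n) * y n = lam * of_real (w n) * y n)"

definition bc_holds :: "(nat \<Rightarrow> nat \<Rightarrow> complex) \<Rightarrow> (nat \<Rightarrow> real) \<Rightarrow> nat
    \<Rightarrow> (nat \<Rightarrow> complex) \<Rightarrow> bool" where
  "bc_holds M f N y \<longleftrightarrow>
     (\<forall>i<2. M i 0 * y 0 + M i 1 * (of_real (f 0) * (y 1 - y 0))
            + M i 2 * y N + M i 3 * (of_real (f N) * (y (N+1) - y N)) = 0)"

definition sol_space :: "(nat \<Rightarrow> real) \<Rightarrow> (nat \<Rightarrow> real) \<Rightarrow> (nat \<Rightarrow> real) \<Rightarrow> nat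
    \<Rightarrow> (nat \<Rightarrow> nat \<Rightarrow> complex) \<Rightarrow> complex \<Rightarrow> (nat \<Rightarrow> complex) set" where
  "sol_space f q w N M lam =
     {y. (\<forall>n>N+1. y n = 0) \<and> sl_eq f q w N lam y \<and> bc_holds M f N y}"

definition is_eigenvalue :: "(nat \<Rightarrow> real) \<Rightarrow> (nat \<Rightarrow> real) \<Rightarrow> (nat \<Rightarrow> real) \<Rightarrow> nat
    \<Rightarrow> (nat \<Rightarrow> nat \<Rightarrow> complex) \<Rightarrow> complex \<Rightarrow> bool" where
  "is_eigenvalue f q w N M lam \<longleftrightarrow> (\<exists>y\<in>sol_space f q w N M lam. y \<noteq> 0)"

definition eig_mult :: "(nat \<Rightarrow> real) \<Rightarrow> (nat \<Rightarrow> real) \<Rightarrow> (nat \<Rightarrow> real) \<Rightarrow> nat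
    \<Rightarrow> (nat \<Rightarrow> nat \<Rightarrow> complex) \<Rightarrow> complex \<Rightarrow> nat" where
  "eig_mult f q w N M lam =
     Vector_Spaces.vector_space.dim (\<lambda>(c::complex) (y::nat \<Rightarrow> complex). (\<lambda>n. c * y n))
       (sol_space f q w N M lam)"

definition has_exactly_eigs :: "(nat \<Rightarrow> real) \<Rightarrow> (nat \<Rightarrow> real) \<Rightarrow> (nat \<Rightarrow> real) \<Rightarrow> nat
    \<Rightarrow> (nat \<Rightarrow> nat \<Rightarrow> complex) \<Rightarrow> nat \<Rightarrow> bool" where
  "has_exactly_eigs f q w N M k \<longleftrightarrow>
     finite {e. is_eigenvalue f q w N M e} \<and>
     (\<Sum>e\<in>{e. is_eigenvalue f q w N M e}. eig_mult f q w N M e) = k"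

definition eig_count_le :: "(nat \<Rightarrow> real) \<Rightarrow> (nat \<Rightarrow> real) \<Rightarrow> (nat \<Rightarrow> real) \<Rightarrow> nat
    \<Rightarrow> (nat \<Rightarrow> nat \<Rightarrow> complex) \<Rightarrow> real \<Rightarrow> nat" where
  "eig_count_le f q w N M x =
     (\<Sum>\<mu>\<in>{\<mu>::real. is_eigenvalue f q w N M (of_real \<mu>) \<and> \<mu> \<le> x}.
        eig_mult f q w N M (of_real \<mu>))"

text \<open>The n-th eigenvalue lambda_n (n = 0, 1, ...) in the nondecreasing ordering
  of the (real) eigenvalues repeated according to multiplicity.\<close>
definition eig :: "(nat \<Rightarrow> real) \<Rightarrow> (nat \<Rightarrow> real) \<Rightarrow> (nat \<Rightarrow> real) \<Rightarrow> nat
    \<Rightarrow> (nat \<Rightarrow> nat \<Rightarrow> complex) \<Rightarrow> nat \<Rightarrow> real" where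
  "eig f q w N M n =
     Min {x::real. is_eigenvalue f q w N M (of_real x) \<and> n < eig_count_le f q w N M x}"

definition bcA :: "real \<Rightarrow> real \<Rightarrow> complex \<Rightarrow> nat \<Rightarrow> nat \<Rightarrow> complex" where
  "bcA a12 b21 z i j = [[1, of_real a12, cnj z, 0], [0, z, of_real b21, 1]] ! i ! j"

definition bcS1 :: "real \<Rightarrow> nat \<Rightarrow> nat \<Rightarrow> complex" where
  "bcS1 b21 i j = [[0, 1, 0, 0], [0, 0, of_real b21, 1]] ! i ! j"

definition bcS2 :: "real \<Rightarrow> nat \<Rightarrow> nat \<Rightarrow> complex" where
  "bcS2 a12 i j = [[1, of_real a12, 0, 0], [0, 0, 1, 0]] ! i ! j"

end

theory Submission
  imports Defs
begin

text \<open>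
  Eliminating \<open>y 0\<close> and \<open>y (N+1)\<close> turns each boundary value problem into a Hermitian pencil
  \<open>Q v u = \<lambda> W v u\<close> on a subspace of \<open>\<complex>\<^sup>N\<close>, where \<open>W\<close> is the weight \<open>w\<close> and
  \[ Q(y) = \sum_{n=1}^{N-1} f_n |\Delta y_n|^2 + \sum_{n=1}^N q_n |y_n|^2 + b_{21} |y_N|^2
     + c\, |y_1 + \bar z y_N|^2, \qquad c = 1 / (1/f_0 - a_{12}). \]
  The condition \<open>S1\<close> is \<open>c = 0\<close>; the value \<open>a12 = 1 / f 0\<close>, i.e. \<open>c = \<infinity>\<close>, restricts the pencil to the
  hyperplane \<open>y 1 + cnj z * y N = 0\<close>; and \<open>S2\<close> restricts it to \<open>y N = 0\<close>. The number of eigenvalues is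
  the dimension of the subspace, and the number of eigenvalues at most \<open>x\<close> is the largest dimension
  of a subspace on which \<open>Q \<le> x W\<close>. The inequalities follow because \<open>Q\<close> is monotone in \<open>b21\<close> and
  \<open>c\<close>, and because passing to a hyperplane lowers these dimensions by at most one.
\<close>

section \<open>Dimension counts\<close>

context vector_space
begin

lemma finite_basis_exists:
  assumes "S \<subseteq> span T" "finite T"
  obtains B where "finite B" "B \<subseteq> S" "independent B" "S \<subseteq> span B" "card B = dim S"
proof -
  obtain B where B: "B \<subseteq> S" "independent B" "S \<subseteq> span B" "card B = dim S"
    by (rule basis_exists)
  moreover have "finite B"
    using independent_span_bound[OF assms(2) B(2)] B(1) assms(1) by blast
  ultimately show ?thesis by (rule_tac that)
qed

text \<open>A basis of the kernel together with \<open>v\<close> is a basis of \<open>S\<close>: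
  subtracting \<open>(l x / l v) v\<close> from \<open>x\<close> lands in the kernel.\<close>

lemma dim_eq_dim_kernel_plus_1:
  assumes l: "Vector_Spaces.linear scale (*) l"
    and S: "subspace S" "S \<subseteq> span T" "finite T"
    and v: "v \<in> S" "l v \<noteq> 0"
  shows "dim S = dim {x \<in> S. l x = 0} + 1"
proof -
  interpret l: Vector_Spaces.linear scale "(*)" l by fact
  let ?K = "{x \<in> S. l x = 0}"
  have K: "subspace ?K"
    using S(1) by (auto simp: subspace_def l.add l.scale)
  obtain B where B: "finite B" "B \<subseteq> ?K" "independent B" "?K \<subseteq> span B" "card B = dim ?K"
    by (rule finite_basis_exists[of ?K T]) (use S in auto)
  have spB: "span B \<subseteq> ?K"
    using B(2) K by (rule span_minimal)
  then have vB: "v \<notin> span B" using v by auto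
  then have "independent (insert v B)"
    using B(3) by (simp add: independent_insert)
  moreover have "S \<subseteq> span (insert v B)"
  proof
    fix x assume x: "x \<in> S"
    have "x - scale (l x / l v) v \<in> ?K"
      using x v S(1) by (simp add: subspace_diff subspace_scale l.diff l.scale)
    then show "x \<in> span (insert v B)"
      using B(4) span_breakdown_eq by blast
  qed
  ultimately have "card (insert v B) = dim S"
    using B(2) v by (intro basis_card_eq_dim) auto
  moreover have "v \<notin> B" using vB span_base by blast
  ultimately show ?thesis using B(1,5) by simp
qed

lemma dim_le_dim_kernel_plus_1:
  assumes l: "Vector_Spaces.linear scale (*) l"
    and S: "subspace S" "S \<subseteq> span T" "finite T"
  shows "dim S \<le> dim {x \<in> S. l x = 0} + 1"
proof (cases "\<exists>v\<in>S. l v \<noteq> 0")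
  case True
  then show ?thesis using dim_eq_dim_kernel_plus_1[OF assms] by auto
next
  case False
  then have "{x \<in> S. l x = 0} = S" by auto
  then show ?thesis by simp
qed

text \<open>Each functional cuts the dimension by at most one, and after all of them nothing is
  left. This is the source of the upper bound in the variational count.\<close>

lemma dim_le_card_functionals:
  assumes "finite I" "\<And>i. i \<in> I \<Longrightarrow> Vector_Spaces.linear scale (*) (l i)"
    and "subspace S" "S \<subseteq> span T" "finite T"
    and "{x \<in> S. \<forall>i\<in>I. l i x = 0} \<subseteq> {0}"
  shows "dim S \<le> card I"
  using assms
proof (induction I arbitrary: S rule: finite_induct)
  case empty
  then have "S \<subseteq> span {}" by auto
  then show ?case using dim_le_card[of S "{}"] by simp
next
  case (insert i I)
  let ?K = "{x \<in> S. l i x = 0}"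
  interpret l: Vector_Spaces.linear scale "(*)" "l i" using insert.prems by blast
  have "subspace ?K"
    using insert.prems(2) by (auto simp: subspace_def l.add l.scale)
  then have "dim ?K \<le> card I"
    using insert.prems by (intro insert.IH) auto
  moreover have "dim S \<le> dim ?K + 1"
    using insert.prems by (intro dim_le_dim_kernel_plus_1) auto
  ultimately show ?case using insert.hyps by simp
qed

end

section \<open>Hermitian pencils\<close>

text \<open>The topology is not tied to the vector space structure, so continuity is assumed.
  Continuity on the diagonal lets a minimum be attained; continuity in the left argument makes
  orthogonal complements closed.\<close>

locale hermitian_form = vector_space scale
  for scale :: "complex \<Rightarrow> 'a::{ab_group_add,topological_space} \<Rightarrow> 'a" +
  fixes H :: "'a \<Rightarrow> 'a \<Rightarrow> complex"
  assumes add_left: "H (u + v) x = H u x + H v x"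
    and scale_left: "H (scale c u) x = c * H u x"
    and hermitian: "H x u = cnj (H u x)"
    and continuous_left: "continuous_on UNIV (\<lambda>u. H u x)"
    and continuous_diag: "continuous_on UNIV (\<lambda>u. H u u)"
begin

lemma linear_left: "Vector_Spaces.linear scale (*) (\<lambda>u. H u x)"
proof -
  interpret m: vector_space "(*) :: complex \<Rightarrow> complex \<Rightarrow> complex"
    by unfold_locales (simp_all add: algebra_simps)
  show ?thesis by unfold_locales (simp_all add: add_left scale_left)
qed

lemma add_right: "H x (u + v) = H x u + H x v"
  using hermitian[of x] by (simp add: add_left)

lemma scale_right: "H x (scale c u) = cnj c * H x u"
  using hermitian[of x] by (simp add: scale_left)

lemma zero_left [simp]: "H 0 x = 0"
  using scale_left[of 0 0 x] by simp

lemma diff_left: "H (u - v) x = H u x - H v x"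
  using add_left[of "u - v" v x] by simp

lemma sum_left: "H (\<Sum>i\<in>I. g i) x = (\<Sum>i\<in>I. H (g i) x)"
  by (induction I rule: infinite_finite_induct) (simp_all add: add_left)

lemma of_real_Re_diag: "of_real (Re (H x x)) = H x x"
  using hermitian[of x x] by (metis Reals_cnj_iff of_real_Re)

text \<open>Supplies the first variation of a diagonal form at \<open>v\<close> in the direction
  \<open>u\<close>.\<close>

lemma diag_add_scale:
  "Re (H (v + scale s u) (v + scale s u)) =
     Re (H v v) + 2 * Re (cnj s * H v u) + (cmod s)\<^sup>2 * Re (H u u)"
proof -
  have "H (v + scale s u) (v + scale s u) =
      H v v + (cnj s * H v u + cnj (cnj s * H v u)) + s * cnj s * H u u"
    by (simp add: add_left add_right scale_left scale_right hermitian[of u v] algebra_simps)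
  also have "s * cnj s * H u u = of_real ((cmod s)\<^sup>2 * Re (H u u))"
    by (simp add: complex_norm_square[symmetric] of_real_Re_diag)
  finally show ?thesis by (simp add: complex_add_cnj)
qed

end

text \<open>The ambient space may be infinite-dimensional and \<open>W\<close> may degenerate
  outside \<open>V\<close>; finiteness, positivity and compactness of the unit sphere are demanded
  on \<open>V\<close> only.\<close>

locale hermitian_pencil = vector_space scale + Q: hermitian_form scale Q + W: hermitian_form scale W
  for scale :: "complex \<Rightarrow> 'a::{ab_group_add,topological_space} \<Rightarrow> 'a"
    and Q W :: "'a \<Rightarrow> 'a \<Rightarrow> complex" +
  fixes V :: "'a set"
  assumes subspace_V: "subspace V"
    and finite_span: "\<exists>T. finite T \<and> V \<subseteq> span T"
    and W_pos: "\<And>v. v \<in> V \<Longrightarrow> v \<noteq> 0 \<Longrightarrow> Re (W v v) > 0"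
    and compact_sphere: "compact {v \<in> V. Re (W v v) = 1}"
begin

section \<open>Existence of an orthonormal eigenbasis\<close>

lemma normalize:
  assumes "v \<in> V" "v \<noteq> 0"
  obtains r :: real where "r > 0" "Re (W (scale (of_real r) v) (scale (of_real r) v)) = 1"
proof
  let ?r = "1 / sqrt (Re (W v v))"
  show "?r > 0" using W_pos[OF assms] by simp
  have "Re (W (scale (of_real ?r) v) (scale (of_real ?r) v)) = ?r * ?r * Re (W v v)"
    by (simp add: W.scale_left W.scale_right del: of_real_divide)
  also have "\<dots> = 1" using W_pos[OF assms] by (simp add: field_simps)
  finally show "Re (W (scale (of_real ?r) v) (scale (of_real ?r) v)) = 1" .
qed

text \<open>\<open>Q\<close> attains its minimum on the \<open>W\<close>-unit sphere of
  \<open>V \<inter> C\<close>, and a minimiser is an eigenvector. The set \<open>C\<close> makes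
  room for the orthogonal complement of the eigenvectors found so far.\<close>

lemma eigenvector_exists:
  assumes C: "closed C" and U: "subspace (V \<inter> C)" "V \<inter> C \<noteq> {0}"
  obtains v m where "v \<in> V \<inter> C" "W v v = 1"
    "\<And>u. u \<in> V \<inter> C \<Longrightarrow> Q v u = of_real m * W v u"
proof -
  let ?K = "{v \<in> V. Re (W v v) = 1} \<inter> C"
  have "compact ?K" using compact_sphere C by (rule compact_Int_closed)
  moreover have "?K \<noteq> {}"
  proof -
    obtain u where u: "u \<in> V \<inter> C" "u \<noteq> 0"
      using U subspace_0 by blast
    then obtain r where "Re (W (scale (of_real r) u) (scale (of_real r) u)) = 1"
      using normalize[of u] by auto
    moreover have "scale (of_real r) u \<in> V \<inter> C"
      using U(1) u(1) by (rule subspace_scale)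
    ultimately show ?thesis by blast
  qed
  moreover have "continuous_on ?K (\<lambda>v. Re (Q v v))"
    by (intro continuous_intros continuous_on_subset[OF Q.continuous_diag]) auto
  ultimately obtain v where v: "v \<in> ?K" and
    min: "\<And>u. u \<in> ?K \<Longrightarrow> Re (Q v v) \<le> Re (Q u u)"
    using continuous_attains_inf[of ?K "\<lambda>v. Re (Q v v)"] by blast
  define m where "m = Re (Q v v)"
  define P where "P = (\<lambda>u. Re (Q u u) - m * Re (W u u))"
  have P_nonneg: "P u \<ge> 0" if u: "u \<in> V \<inter> C" for u
  proof (cases "u = 0")
    case False
    then obtain r where r: "r > 0" "Re (W (scale (of_real r) u) (scale (of_real r) u)) = 1"
      using normalize[of u] u by auto
    have "scale (of_real r) u \<in> V \<inter> C"
      using U(1) u by (rule subspace_scale)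
    with r(2) min have "m \<le> Re (Q (scale (of_real r) u) (scale (of_real r) u))"
      by (auto simp: m_def)
    then have "m * Re (W (scale (of_real r) u) (scale (of_real r) u)) \<le> Re (Q (scale (of_real r) u) (scale (of_real r) u))"
      using r(2) by simp
    then have "0 \<le> r * r * P u"
      by (simp add: P_def Q.scale_left Q.scale_right W.scale_left W.scale_right algebra_simps)
    then show ?thesis using mult_pos_pos[OF r(1) r(1)] by (simp add: zero_le_mult_iff)
  qed (simp add: P_def)
  show ?thesis
  proof
    show "v \<in> V \<inter> C" using v by auto
    show "W v v = 1" using W.of_real_Re_diag[of v] v by simp
    fix u assume u: "u \<in> V \<inter> C"
    \<comment> \<open>\<open>P\<close> is nonnegative and vanishes at \<open>v\<close>, so its first variation at \<open>v\<close> is zero.\<close>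
    define p where "p = Q v u - of_real m * W v u"
    \<comment> \<open>This step length gives \<open>t * P u < 1\<close>. Moving from
      \<open>v\<close> by \<open>- t p u\<close> then changes \<open>P\<close> by
      \<open>t |p|^2 (t P u - 2)\<close>, which is negative unless \<open>p = 0\<close>.\<close>
    define t where "t = 1 / (1 + P u)"
    have t: "t > 0" using P_nonneg[OF u] by (simp add: t_def)
    have Pv: "P v = 0" using v by (simp add: P_def m_def)
    have Ps: "P (v + scale s u) = 2 * Re (cnj s * p) + (cmod s)\<^sup>2 * P u" for s
      using Pv by (simp add: P_def Q.diag_add_scale W.diag_add_scale p_def algebra_simps)
    let ?s = "of_real (- t) * p"
    have "v + scale ?s u \<in> V \<inter> C"
      using U(1) u v by (intro subspace_add subspace_scale) auto
    then have "0 \<le> P (v + scale ?s u)" by (rule P_nonneg)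
    also have "\<dots> = 2 * Re (of_real (- t) * (cnj p * p)) + (cmod ?s)\<^sup>2 * P u"
      by (simp only: Ps complex_cnj_mult complex_cnj_complex_of_real mult.assoc)
    also have "cnj p * p = of_real ((cmod p)\<^sup>2)"
      by (simp only: complex_norm_square mult.commute)
    also have "Re (of_real (- t) * of_real ((cmod p)\<^sup>2)) = - t * (cmod p)\<^sup>2"
      by (simp only: of_real_mult[symmetric] Re_complex_of_real)
    also have "2 * (- t * (cmod p)\<^sup>2) + (cmod ?s)\<^sup>2 * P u = t * (cmod p)\<^sup>2 * (t * P u - 2)"
      using t by (simp add: norm_mult power_mult_distrib algebra_simps power2_eq_square)
    finally have "t * 0 \<le> t * ((cmod p)\<^sup>2 * (t * P u - 2))"
      by (simp only: mult.assoc mult_zero_right)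
    then have "0 \<le> (cmod p)\<^sup>2 * (t * P u - 2)"
      by (simp only: mult_le_cancel_left_pos[OF t])
    moreover have "t * P u - 2 < 0"
      using P_nonneg[OF u] by (simp add: t_def field_simps)
    ultimately have "p = 0"
      by (auto simp: zero_le_mult_iff)
    then show "Q v u = of_real m * W v u" by (simp add: p_def)
  qed
qed

text \<open>The eigenvalue equation is weak: it is tested against \<open>V\<close> only, because
  \<open>Q\<close> need not come from an operator on \<open>V\<close>. The eigenvalues
  \<open>m\<close> are real by type.\<close>

definition eigensystem :: "'a set \<Rightarrow> ('a \<Rightarrow> real) \<Rightarrow> bool" where
  "eigensystem B m \<longleftrightarrow> finite B \<and> B \<subseteq> V \<and>
     (\<forall>b\<in>B. \<forall>b'\<in>B. W b b' = (if b = b' then 1 else 0)) \<and>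
     (\<forall>b\<in>B. \<forall>x\<in>V. Q b x = of_real (m b) * W b x)"

lemma W_sum_orthonormal:
  assumes B: "eigensystem B m" and "b \<in> B" "A \<subseteq> B"
  shows "W (\<Sum>a\<in>A. scale (c a) a) b = (if b \<in> A then c b else 0)"
proof -
  have fA: "finite A" using assms by (auto simp: eigensystem_def intro: finite_subset)
  have "W (\<Sum>a\<in>A. scale (c a) a) b = (\<Sum>a\<in>A. if a = b then c a else 0)"
    unfolding W.sum_left W.scale_left
    using assms by (intro sum.cong) (auto simp: eigensystem_def)
  also have "\<dots> = (if b \<in> A then c b else 0)"
    using fA by simp
  finally show ?thesis .
qed

lemma eigensystem_independent:
  assumes B: "eigensystem B m"
  shows "independent B"
proof -
  have "c v = 0" if "A \<subseteq> B" "(\<Sum>a\<in>A. scale (c a) a) = 0" "v \<in> A" for A c v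
    using W_sum_orthonormal[OF B, of v A c] that by auto
  then show ?thesis unfolding independent_explicit_module by blast
qed

text \<open>Spectral theorem by maximality: eigensystems are independent, hence of bounded size, and
  one of largest size must span \<open>V\<close>, since a nonzero orthogonal complement would
  contribute a further eigenvector.\<close>

lemma eigenbasis_exists:
  obtains B m where "eigensystem B m" "V \<subseteq> span B"
proof -
  obtain T where T: "finite T" "V \<subseteq> span T" using finite_span by blast
  define ok where "ok k \<longleftrightarrow> (\<exists>B m. eigensystem B m \<and> card B = k)" for k
  have "ok 0" unfolding ok_def by (intro exI[of _ "{}"]) (auto simp: eigensystem_def)
  moreover have "k \<le> card T" if "ok k" for k
  proof -
    from that obtain B m where B: "eigensystem B m" "card B = k" unfolding ok_def by blast
    then have "B \<subseteq> span T" using T by (auto simp: eigensystem_def)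
    then show ?thesis
      using independent_span_bound[OF T(1) eigensystem_independent[OF B(1)]] B(2) by auto
  qed
  ultimately obtain k where k: "ok k" "\<And>j. ok j \<Longrightarrow> j \<le> k"
    using Nat.ex_has_greatest_nat[of ok 0 "card T"] by blast
  from k(1) obtain B m where B: "eigensystem B m" "card B = k" unfolding ok_def by blast
  have BV: "B \<subseteq> V" "finite B" using B(1) by (auto simp: eigensystem_def)
  define C where "C = {x. \<forall>b\<in>B. W x b = 0}"
  have "C = (\<Inter>b\<in>B. {x. W x b = 0})" by (auto simp: C_def)
  then have "closed C"
    by (simp only:) (intro closed_INT ballI closed_Collect_eq W.continuous_left continuous_on_const)
  have sub: "subspace (V \<inter> C)"
    using subspace_V by (auto simp: subspace_def C_def W.add_left W.scale_left)
  have resid: "x - (\<Sum>b\<in>B. scale (W x b) b) \<in> V \<inter> C" if "x \<in> V" for x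
    using that BV W_sum_orthonormal[OF B(1) _ order_refl]
    by (auto simp: C_def W.diff_left intro!: subspace_diff subspace_sum subspace_scale subspace_V)
  have "V \<inter> C = {0}"
  proof (rule ccontr)
    assume "V \<inter> C \<noteq> {0}"
    then obtain v l where v: "v \<in> V \<inter> C" "W v v = 1"
      and vQ: "\<And>u. u \<in> V \<inter> C \<Longrightarrow> Q v u = of_real l * W v u"
      using eigenvector_exists[OF \<open>closed C\<close> sub] by blast
    have vW: "W v b = 0" "W b v = 0" if "b \<in> B" for b
      using v(1) that W.hermitian[of b v] by (auto simp: C_def)
    have vB: "v \<notin> B" using vW v(2) by force
    have vQb: "Q v b = 0" if "b \<in> B" for b
    proof -
      have "Q b v = of_real (m b) * W b v" using B(1) that v(1) by (auto simp: eigensystem_def)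
      then show ?thesis using vW that Q.hermitian[of v b] by simp
    qed
    \<comment> \<open>So far \<open>v\<close> is an eigenvector against the complement only. The
      rest of \<open>x\<close> lies in the span of \<open>B\<close>, where both \<open>Q v\<close>
      and \<open>W v\<close> vanish.\<close>
    have vQV: "Q v x = of_real l * W v x" if x: "x \<in> V" for x
    proof -
      let ?s = "\<Sum>b\<in>B. scale (W x b) b"
      have "W ?s v = 0" "Q ?s v = 0"
        unfolding W.sum_left Q.sum_left W.scale_left Q.scale_left
        using vW vQb Q.hermitian[of _ v] by (auto intro!: sum.neutral)
      then have "W v ?s = 0" "Q v ?s = 0"
        using W.hermitian[of v ?s] Q.hermitian[of v ?s] by auto
      then show ?thesis
        using vQ[OF resid[OF x]] Q.add_right[of v "x - ?s" ?s] W.add_right[of v "x - ?s" ?s] by simp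
    qed
    have "eigensystem (insert v B) (m(v := l))"
      using B(1) v vW vQV vB unfolding eigensystem_def by (auto simp: fun_upd_def)
    then have "ok (Suc k)" unfolding ok_def using vB BV B(2) by (metis card_insert_disjoint)
    then show False using k(2) by fastforce
  qed
  then have "x = (\<Sum>b\<in>B. scale (W x b) b)" if "x \<in> V" for x
    using resid[OF that] by simp
  then have "V \<subseteq> span B"
    by (metis (no_types, lifting) span_base span_scale span_sum subsetI)
  then show ?thesis using B(1) that by blast
qed

lemma eigenbasis_expansion:
  assumes B: "eigensystem B m" "V \<subseteq> span B" and x: "x \<in> V"
  shows "x = (\<Sum>b\<in>B. scale (W x b) b)"
proof -
  have "finite B" using B by (simp add: eigensystem_def)
  then obtain c where c: "x = (\<Sum>b\<in>B. scale (c b) b)"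
    using B(2) x by (auto simp: span_finite)
  then have "W x b = c b" if "b \<in> B" for b
    using W_sum_orthonormal[OF B(1) that order_refl] that by auto
  then show ?thesis using c by simp
qed

lemma diag_expansion:
  assumes B: "eigensystem B m" "V \<subseteq> span B" and x: "x \<in> V"
  shows "Re (Q x x) = (\<Sum>b\<in>B. m b * (cmod (W x b))\<^sup>2)"
    and "Re (W x x) = (\<Sum>b\<in>B. (cmod (W x b))\<^sup>2)"
proof -
  have *: "W x b * W b x = of_real ((cmod (W x b))\<^sup>2)" for b
    by (simp only: W.hermitian[of b x] complex_norm_square)
  have "Q x x = (\<Sum>b\<in>B. W x b * Q b x)"
    using arg_cong[OF eigenbasis_expansion[OF assms], of "\<lambda>u. Q u x"]
    by (simp add: Q.sum_left Q.scale_left)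
  also have "\<dots> = (\<Sum>b\<in>B. of_real (m b) * (W x b * W b x))"
    using B(1) x by (intro sum.cong) (auto simp: eigensystem_def)
  finally show "Re (Q x x) = (\<Sum>b\<in>B. m b * (cmod (W x b))\<^sup>2)"
    by (simp add: *)
  have "W x x = (\<Sum>b\<in>B. W x b * W b x)"
    using arg_cong[OF eigenbasis_expansion[OF assms], of "\<lambda>u. W u x"]
    by (simp add: W.sum_left W.scale_left)
  then show "Re (W x x) = (\<Sum>b\<in>B. (cmod (W x b))\<^sup>2)"
    by (simp add: *)
qed

section \<open>Eigenspaces and the variational count of eigenvalues\<close>

definition eigenspace :: "complex \<Rightarrow> 'a set" where
  "eigenspace l = {v \<in> V. \<forall>u\<in>V. Q v u = l * W v u}"

text \<open>Testing against \<open>b\<close> gives \<open>l * W v b = m b * W v b\<close>, so only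
  basis vectors with eigenvalue \<open>l\<close> contribute. As \<open>l\<close> is an arbitrary
  complex number, this also shows that there are no non-real eigenvalues.\<close>

lemma eigenspace_eq_span:
  assumes B: "eigensystem B m" "V \<subseteq> span B"
  shows "eigenspace l = span {b \<in> B. of_real (m b) = l}"
proof (intro equalityI subsetI)
  fix v assume v: "v \<in> eigenspace l"
  then have vV: "v \<in> V" by (simp add: eigenspace_def)
  have "scale (W v b) b \<in> span {b \<in> B. of_real (m b) = l}" if b: "b \<in> B" for b
  proof (cases "of_real (m b) = l")
    case False
    have bV: "b \<in> V" using B(1) b by (auto simp: eigensystem_def)
    have "l * W v b = Q v b" using v bV by (simp add: eigenspace_def)
    also have "\<dots> = cnj (of_real (m b) * W b v)"
      using B(1) b vV by (subst Q.hermitian) (auto simp: eigensystem_def)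
    also have "\<dots> = of_real (m b) * W v b"
      using W.hermitian[of v b] by simp
    finally show ?thesis using False by (simp add: span_zero)
  qed (use b in \<open>auto intro: span_scale span_base\<close>)
  then show "v \<in> span {b \<in> B. of_real (m b) = l}"
    by (subst eigenbasis_expansion[OF B vV]) (rule span_sum)
next
  fix v assume v: "v \<in> span {b \<in> B. of_real (m b) = l}"
  have "subspace (eigenspace l)"
    using subspace_V
    by (auto simp: subspace_def eigenspace_def Q.add_left W.add_left Q.scale_left W.scale_left algebra_simps)
  moreover have "{b \<in> B. of_real (m b) = l} \<subseteq> eigenspace l"
    using B(1) by (auto simp: eigensystem_def eigenspace_def)
  ultimately show "v \<in> eigenspace l" using v span_minimal by blast
qed

lemma dim_eigenspace:
  assumes B: "eigensystem B m" "V \<subseteq> span B"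
  shows "dim (eigenspace l) = card {b \<in> B. of_real (m b) = l}"
  unfolding eigenspace_eq_span[OF B]
  by (intro dim_span_eq_card_independent independent_mono[OF eigensystem_independent[OF B(1)]]) auto

lemma eigenspace_nontrivial_iff:
  assumes B: "eigensystem B m" "V \<subseteq> span B"
  shows "(\<exists>v\<in>eigenspace l. v \<noteq> 0) \<longleftrightarrow> (\<exists>b\<in>B. of_real (m b) = l)"
proof
  assume "\<exists>b\<in>B. of_real (m b) = l"
  then obtain b where b: "b \<in> B" "of_real (m b) = l" by blast
  then have "b \<in> eigenspace l" unfolding eigenspace_eq_span[OF B] by (auto intro: span_base)
  moreover have "W b b = 1" using B(1) b(1) by (simp add: eigensystem_def)
  then have "b \<noteq> 0" by auto
  ultimately show "\<exists>v\<in>eigenspace l. v \<noteq> 0" by blast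
next
  assume nz: "\<exists>v\<in>eigenspace l. v \<noteq> 0"
  show "\<exists>b\<in>B. of_real (m b) = l"
  proof (rule ccontr)
    assume "\<not> ?thesis"
    then have "{b \<in> B. of_real (m b) = l} = {}" by auto
    then show False using nz unfolding eigenspace_eq_span[OF B] by (simp only: span_empty) auto
  qed
qed

lemma dim_V_eq_card:
  assumes B: "eigensystem B m" "V \<subseteq> span B"
  shows "dim V = card B"
  using basis_card_eq_dim[of B V] B eigensystem_independent[OF B(1)] by (simp add: eigensystem_def)

text \<open>A vector of \<open>S\<close> orthogonal to all eigenvectors with eigenvalue at most
  \<open>x\<close> is zero: its expansion makes \<open>Q - x W\<close> a sum of nonnegative terms,
  while on \<open>S\<close> that form is at most zero. The low coefficients are thus functionals
  with trivial common kernel.\<close>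

lemma dim_le_count:
  assumes B: "eigensystem B m" "V \<subseteq> span B"
    and S: "subspace S" "S \<subseteq> V" "\<And>v. v \<in> S \<Longrightarrow> Re (Q v v) \<le> x * Re (W v v)"
  shows "dim S \<le> card {b \<in> B. m b \<le> x}"
proof (rule dim_le_card_functionals[where l = "\<lambda>b v. W v b"])
  have fB: "finite B" using B by (simp add: eigensystem_def)
  then show "finite {b \<in> B. m b \<le> x}" by simp
  show "finite B" by fact
  show "S \<subseteq> span B" using S(2) B(2) by blast
  show "{v \<in> S. \<forall>b\<in>{b \<in> B. m b \<le> x}. W v b = 0} \<subseteq> {0}"
  proof clarify
    fix v assume v: "v \<in> S" and v0: "\<forall>b\<in>{b \<in> B. m b \<le> x}. W v b = 0"
    have vV: "v \<in> V" using v S(2) by blast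
    have nonneg: "0 \<le> (m b - x) * (cmod (W v b))\<^sup>2" if "b \<in> B" for b
      using v0 that by (cases "m b \<le> x") auto
    have "(\<Sum>b\<in>B. (m b - x) * (cmod (W v b))\<^sup>2) = Re (Q v v) - x * Re (W v v)"
      by (simp add: diag_expansion[OF B vV] sum_distrib_left left_diff_distrib sum_subtractf)
    also have "\<dots> \<le> 0" using S(3)[OF v] by simp
    finally have "\<forall>b\<in>B. (m b - x) * (cmod (W v b))\<^sup>2 = 0"
      using sum_nonneg_0[OF fB nonneg] sum_nonneg[of B, OF nonneg] by (meson order_antisym)
    then have "W v b = 0" if "b \<in> B" for b
      using v0 that by (cases "m b \<le> x") auto
    then show "v = 0" by (subst eigenbasis_expansion[OF B vV]) simp
  qed
qed (use S W.linear_left in auto)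

text \<open>Shows that the bound of \<open>dim_le_count\<close> is attained.\<close>

lemma span_low_eigenvectors:
  fixes x :: real
  assumes B: "eigensystem B m" "V \<subseteq> span B"
  defines "S \<equiv> span {b \<in> B. m b \<le> x}"
  shows "S \<subseteq> V" "dim S = card {b \<in> B. m b \<le> x}"
    and "v \<in> S \<Longrightarrow> Re (Q v v) \<le> x * Re (W v v)"
proof -
  show SV: "S \<subseteq> V" unfolding S_def
    using B(1) by (intro span_minimal subspace_V) (auto simp: eigensystem_def)
  show "dim S = card {b \<in> B. m b \<le> x}" unfolding S_def
    by (intro dim_span_eq_card_independent independent_mono[OF eigensystem_independent[OF B(1)]]) auto
  assume v: "v \<in> S"
  then have vV: "v \<in> V" using SV by blast
  have fB: "finite B" using B(1) by (simp add: eigensystem_def)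
  obtain c where c: "v = (\<Sum>b\<in>{b \<in> B. m b \<le> x}. scale (c b) b)"
    using v fB unfolding S_def by (auto simp: span_finite)
  have "W v b = 0" if "b \<in> B" "\<not> m b \<le> x" for b
    unfolding c using that by (subst W_sum_orthonormal[OF B(1) that(1)]) auto
  then have "(\<Sum>b\<in>B. m b * (cmod (W v b))\<^sup>2) \<le> (\<Sum>b\<in>B. x * (cmod (W v b))\<^sup>2)"
    by (intro sum_mono) (metis mult_eq_0_iff mult_right_mono norm_eq_zero order_refl power_zero_numeral zero_le_power2)
  then show "Re (Q v v) \<le> x * Re (W v v)"
    by (simp add: diag_expansion[OF B vV] sum_distrib_left)
qed

end

lemma (in vector_space) dim_inj_image:
  assumes g: "Vector_Spaces.linear scale scale g" and S: "subspace S" "inj_on g S"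
  shows "dim (g ` S) = dim S"
proof -
  interpret g: Vector_Spaces.linear scale scale g by fact
  obtain B where B: "B \<subseteq> S" "independent B" "S \<subseteq> span B" "card B = dim S"
    by (rule basis_exists)
  have sp: "span B = S" using span_subspace[OF B(1,3) S(1)] .
  have "independent (g ` B)"
    using g.independent_injective_image[OF B(2)] S(2) sp by simp
  moreover have "g ` S \<subseteq> span (g ` B)"
    using g.spans_image[OF B(3)] .
  ultimately have "card (g ` B) = dim (g ` S)"
    using B(1) by (intro basis_card_eq_dim) auto
  then show ?thesis
    using card_image[OF inj_on_subset[OF S(2) B(1)]] B(4) by simp
qed

section \<open>Problems realised by a pencil\<close>

interpretation seq: vector_space "\<lambda>(c::complex) (y::nat \<Rightarrow> complex) n. c * y n"
  by unfold_locales (auto simp: fun_eq_iff algebra_simps)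

definition restr :: "nat \<Rightarrow> (nat \<Rightarrow> complex) \<Rightarrow> nat \<Rightarrow> complex" where
  "restr N y = (\<lambda>n. if n \<in> {1..N} then y n else 0)"

lemma linear_restr:
  "Vector_Spaces.linear (\<lambda>c y n. c * y n) (\<lambda>c y n. c * y n) (restr N)"
  by unfold_locales (auto simp: restr_def fun_eq_iff)

lemma subspace_sol_space: "seq.subspace (sol_space f q w N M l)"
proof -
  have "sl_eq f q w N l (x + y)" if "sl_eq f q w N l x" "sl_eq f q w N l y" for x y
    unfolding sl_eq_def
  proof
    fix n assume n: "n \<in> {1..N}"
    show "- (of_real (f n) * ((x + y) (n+1) - (x + y) n) - of_real (f (n-1)) * ((x + y) n - (x + y) (n-1)))
        + of_real (q n) * (x + y) n = l * of_real (w n) * (x + y) n"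
      using arg_cong2[where f = "(+)", OF bspec[OF that(1)[unfolded sl_eq_def] n]
          bspec[OF that(2)[unfolded sl_eq_def] n]]
      by (simp add: algebra_simps)
  qed
  moreover have "sl_eq f q w N l (\<lambda>n. c * x n)" if "sl_eq f q w N l x" for x c
    unfolding sl_eq_def
  proof
    fix n assume n: "n \<in> {1..N}"
    show "- (of_real (f n) * (c * x (n+1) - c * x n) - of_real (f (n-1)) * (c * x n - c * x (n-1)))
        + of_real (q n) * (c * x n) = l * of_real (w n) * (c * x n)"
      using arg_cong[OF bspec[OF that(1)[unfolded sl_eq_def] n], of "\<lambda>t. c * t"]
      by (simp add: algebra_simps)
  qed
  moreover have "bc_holds M f N (x + y)" if "bc_holds M f N x" "bc_holds M f N y" for x y
    unfolding bc_holds_def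
  proof (intro allI impI)
    fix i :: nat assume i: "i < 2"
    show "M i 0 * (x + y) 0 + M i 1 * (of_real (f 0) * ((x + y) 1 - (x + y) 0))
            + M i 2 * (x + y) N + M i 3 * (of_real (f N) * ((x + y) (N+1) - (x + y) N)) = 0"
      using arg_cong2[where f = "(+)", OF that(1)[unfolded bc_holds_def, rule_format, OF i]
          that(2)[unfolded bc_holds_def, rule_format, OF i]]
      by (simp add: algebra_simps)
  qed
  moreover have "bc_holds M f N (\<lambda>n. c * x n)" if "bc_holds M f N x" for x c
    unfolding bc_holds_def
  proof (intro allI impI)
    fix i :: nat assume i: "i < 2"
    show "M i 0 * (c * x 0) + M i 1 * (of_real (f 0) * (c * x 1 - c * x 0))
            + M i 2 * (c * x N) + M i 3 * (of_real (f N) * (c * x (N+1) - c * x N)) = 0"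
      using arg_cong[OF that(1)[unfolded bc_holds_def, rule_format, OF i], of "\<lambda>t. c * t"]
      by (simp add: algebra_simps)
  qed
  moreover have "sl_eq f q w N l 0" "bc_holds M f N 0"
    by (auto simp: sl_eq_def bc_holds_def)
  ultimately show ?thesis
    unfolding seq.subspace_def sol_space_def by auto
qed

text \<open>The rows 1 and \<open>N\<close> of the equation determine \<open>y 0\<close> and
  \<open>y (N+1)\<close> from the interior values, because \<open>f 0\<close> and \<open>f N\<close>
  are nonzero.\<close>

lemma inj_on_restr_sol_space:
  assumes "N \<ge> 2" "\<forall>n\<le>N. f n \<noteq> 0"
  shows "inj_on (restr N) (sol_space f q w N M l)"
proof (rule inj_onI)
  fix x y assume x: "x \<in> sol_space f q w N M l" and y: "y \<in> sol_space f q w N M l"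
    and eq: "restr N x = restr N y"
  have mid: "x n = y n" if "n \<in> {1..N}" for n
    using fun_cong[OF eq, of n] that by (simp add: restr_def del: One_nat_def)
  have left: "of_real (f 0) * v 0 = of_real (f 0) * v 1 - of_real (f 1) * (v 2 - v 1)
      + of_real (q 1) * v 1 - l * of_real (w 1) * v 1"
    and right: "of_real (f N) * v (N+1) = of_real (f N) * v N + of_real (f (N-1)) * (v N - v (N-1))
      + of_real (q N) * v N - l * of_real (w N) * v N"
    if "v \<in> sol_space f q w N M l" for v
  proof -
    have e: "- (of_real (f n) * (v (n+1) - v n) - of_real (f (n-1)) * (v n - v (n-1)))
        + of_real (q n) * v n = l * of_real (w n) * v n" if "n \<in> {1..N}" for n
      using \<open>v \<in> _\<close> that unfolding sol_space_def sl_eq_def by blast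
    show "of_real (f 0) * v 0 = of_real (f 0) * v 1 - of_real (f 1) * (v 2 - v 1)
      + of_real (q 1) * v 1 - l * of_real (w 1) * v 1"
      using e[of 1] assms(1) by (simp add: algebra_simps numeral_2_eq_2)
    show "of_real (f N) * v (N+1) = of_real (f N) * v N + of_real (f (N-1)) * (v N - v (N-1))
      + of_real (q N) * v N - l * of_real (w N) * v N"
      using e[of N] assms(1) by (simp add: algebra_simps)
  qed
  have "x 1 = y 1" "x 2 = y 2" "x N = y N" "x (N-1) = y (N-1)"
    using mid assms(1) by auto
  then have "of_real (f 0) * x 0 = of_real (f 0) * y 0" "of_real (f N) * x (N+1) = of_real (f N) * y (N+1)"
    by (simp_all only: left[OF x] left[OF y] right[OF x] right[OF y])
  then have 0: "x 0 = y 0" and N: "x (N+1) = y (N+1)" using assms(2) by auto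
  show "x = y"
  proof
    fix n
    consider "n = 0" | "n \<in> {1..N}" | "n = N + 1" | "n > N + 1" by fastforce
    then show "x n = y n"
    proof cases
      case 4
      then show ?thesis using x y unfolding sol_space_def by simp
    qed (use 0 N mid in auto)
  qed
qed

text \<open>Both assumptions hold for every complex \<open>l\<close>; together they identify
  eigenvalues and multiplicities of the boundary value problem with those of the pencil.\<close>

locale sl_realization =
  hermitian_pencil "\<lambda>(c::complex) (y::nat \<Rightarrow> complex) n. c * y n" Q W V for Q W V +
  fixes f q w :: "nat \<Rightarrow> real" and N :: nat and M :: "nat \<Rightarrow> nat \<Rightarrow> complex"
  assumes restr_sol_space: "restr N ` sol_space f q w N M l = eigenspace l"
    and inj_restr: "inj_on (restr N) (sol_space f q w N M l)"
begin

lemma eig_mult_eq: "eig_mult f q w N M l = dim (eigenspace l)"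
  unfolding eig_mult_def restr_sol_space[symmetric]
  by (rule seq.dim_inj_image[OF linear_restr subspace_sol_space inj_restr, symmetric])

lemma is_eigenvalue_iff: "is_eigenvalue f q w N M l \<longleftrightarrow> (\<exists>v\<in>eigenspace l. v \<noteq> 0)"
proof -
  have z: "0 \<in> sol_space f q w N M l"
    using subspace_sol_space by (rule seq.subspace_0)
  have r0: "restr N 0 = 0" by (auto simp: restr_def)
  have "restr N y \<noteq> 0 \<longleftrightarrow> y \<noteq> 0" if "y \<in> sol_space f q w N M l" for y
    using inj_on_eq_iff[OF inj_restr that z] r0 by simp
  then show ?thesis
    unfolding is_eigenvalue_def restr_sol_space[symmetric] by auto
qed

text \<open>Listing eigenvalues with multiplicity amounts to listing \<open>B\<close>: the fibre of
  \<open>m\<close> over an eigenvalue is a basis of its eigenspace.\<close>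

lemma eigenvalues_by_eigenbasis:
  assumes B: "eigensystem B m" "V \<subseteq> span B"
  shows "is_eigenvalue f q w N M l \<longleftrightarrow> (\<exists>b\<in>B. of_real (m b) = l)"
    and "eig_mult f q w N M l = card {b \<in> B. of_real (m b) = l}"
    and "eig_count_le f q w N M x = card {b \<in> B. m b \<le> x}"
proof -
  have fB: "finite B" using B(1) by (simp add: eigensystem_def)
  show *: "is_eigenvalue f q w N M l \<longleftrightarrow> (\<exists>b\<in>B. of_real (m b) = l)" for l
    by (simp only: is_eigenvalue_iff eigenspace_nontrivial_iff[OF B])
  show **: "eig_mult f q w N M l = card {b \<in> B. of_real (m b) = l}" for l
    by (simp only: eig_mult_eq dim_eigenspace[OF B])
  let ?L = "{b \<in> B. m b \<le> x}"
  have "{\<mu>::real. is_eigenvalue f q w N M (of_real \<mu>) \<and> \<mu> \<le> x} = m ` ?L"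
    by (auto simp: *)
  then have "eig_count_le f q w N M x = (\<Sum>\<mu>\<in>m ` ?L. card {b \<in> B. m b = \<mu>})"
    by (simp add: eig_count_le_def **)
  also have "\<dots> = (\<Sum>\<mu>\<in>m ` ?L. \<Sum>b\<in>{b \<in> ?L. m b = \<mu>}. 1)"
    by (auto intro!: sum.cong arg_cong[of _ _ card])
  also have "\<dots> = card ?L"
    using fB by (subst sum.image_gen[symmetric]) auto
  finally show "eig_count_le f q w N M x = card ?L" .
qed

lemma has_exactly_eigs_dim: "has_exactly_eigs f q w N M (dim V)"
proof -
  obtain B m where B: "eigensystem B m" "V \<subseteq> span B" by (rule eigenbasis_exists)
  have fB: "finite B" using B(1) by (simp add: eigensystem_def)
  let ?g = "\<lambda>b. complex_of_real (m b)"
  have E: "{e. is_eigenvalue f q w N M e} = ?g ` B"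
    by (auto simp: eigenvalues_by_eigenbasis(1)[OF B])
  have "(\<Sum>e\<in>?g ` B. eig_mult f q w N M e) = (\<Sum>e\<in>?g ` B. \<Sum>b\<in>{b \<in> B. ?g b = e}. 1)"
    by (simp add: eigenvalues_by_eigenbasis(2)[OF B])
  also have "\<dots> = card B"
    using fB by (subst sum.image_gen[symmetric]) auto
  also have "\<dots> = dim V" using dim_V_eq_card[OF B] by simp
  finally show ?thesis unfolding has_exactly_eigs_def E using fB by simp
qed

text \<open>Translates inequalities between ordered eigenvalues into inequalities between counts, to
  which dimension arguments apply. The bound on \<open>n\<close> keeps the set under
  \<open>Min\<close> nonempty.\<close>

lemma eig_le_iff:
  assumes n: "n < dim V"
  shows "eig f q w N M n \<le> x \<longleftrightarrow> n < eig_count_le f q w N M x"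
proof -
  obtain B m where B: "eigensystem B m" "V \<subseteq> span B" by (rule eigenbasis_exists)
  have fB: "finite B" using B(1) by (simp add: eigensystem_def)
  note [simp] = eigenvalues_by_eigenbasis[OF B]
  define X where "X = {x::real. is_eigenvalue f q w N M (of_real x) \<and> n < eig_count_le f q w N M x}"
  have "X \<subseteq> m ` B" by (auto simp: X_def)
  then have fX: "finite X" using fB finite_subset by blast
  have below: "\<exists>x'\<in>X. x' \<le> x" if "n < eig_count_le f q w N M x" for x
  proof -
    let ?L = "{b \<in> B. m b \<le> x}"
    have "card ?L \<noteq> 0" using that by simp
    then have "\<not> (?L = {} \<or> infinite ?L)" by (simp only: card_eq_0_iff) simp
    then have L: "?L \<noteq> {}" "finite ?L" by blast+
    \<comment> \<open>Round \<open>x\<close> down to the largest eigenvalue not exceeding it; this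
      loses no eigenvalue from the count.\<close>
    define x' where "x' = Max (m ` ?L)"
    have x': "x' \<in> m ` ?L" unfolding x'_def using L by (intro Max_in) auto
    have "?L \<subseteq> {b \<in> B. m b \<le> x'}" unfolding x'_def using L by auto
    then have "card ?L \<le> card {b \<in> B. m b \<le> x'}" using fB by (intro card_mono) auto
    then have "x' \<in> X" using x' that by (auto simp: X_def)
    then show ?thesis using x' by auto
  qed
  \<comment> \<open>At the largest eigenvalue the count is the full dimension, which exceeds
    \<open>n\<close>.\<close>
  have "{b \<in> B. m b \<le> Max (m ` B)} = B" using fB by auto
  then have "n < eig_count_le f q w N M (Max (m ` B))"
    using n dim_V_eq_card[OF B] by simp
  then have neX: "X \<noteq> {}" using below by blast
  have "eig f q w N M n = Min X" by (simp add: eig_def X_def)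
  then have "eig f q w N M n \<le> x \<longleftrightarrow> (\<exists>x'\<in>X. x' \<le> x)"
    using fX neX by (simp add: Min_le_iff)
  also have "\<dots> \<longleftrightarrow> n < eig_count_le f q w N M x"
  proof
    assume "\<exists>x'\<in>X. x' \<le> x"
    then obtain x' where "x' \<in> X" "x' \<le> x" by blast
    moreover from this have "card {b \<in> B. m b \<le> x'} \<le> card {b \<in> B. m b \<le> x}"
      using fB by (intro card_mono) auto
    ultimately show "n < eig_count_le f q w N M x" by (simp add: X_def)
  qed (rule below)
  finally show ?thesis .
qed

lemma dim_le_eig_count:
  assumes "subspace S" "S \<subseteq> V" "\<And>v. v \<in> S \<Longrightarrow> Re (Q v v) \<le> x * Re (W v v)"
  shows "dim S \<le> eig_count_le f q w N M x"
proof -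
  obtain B m where B: "eigensystem B m" "V \<subseteq> span B" by (rule eigenbasis_exists)
  show ?thesis using dim_le_count[OF B assms] by (simp add: eigenvalues_by_eigenbasis[OF B])
qed

lemma eig_count_attained:
  obtains S where "subspace S" "S \<subseteq> V" "dim S = eig_count_le f q w N M x"
    "\<And>v. v \<in> S \<Longrightarrow> Re (Q v v) \<le> x * Re (W v v)"
proof -
  obtain B m where B: "eigensystem B m" "V \<subseteq> span B" by (rule eigenbasis_exists)
  show ?thesis
    using that[of "span {b \<in> B. m b \<le> x}"] span_low_eigenvectors[OF B, where x = x]
    by (simp add: eigenvalues_by_eigenbasis[OF B])
qed

end

text \<open>A subspace that witnesses the count of the second problem at its \<open>n\<close>-th
  eigenvalue also serves for the first, whose form is smaller and whose space is larger.\<close>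

lemma eig_mono:
  assumes 1: "sl_realization Q1 W V1 f q w N M1" and 2: "sl_realization Q2 W V2 f q w N M2"
    and n: "n < seq.dim V1" "n < seq.dim V2"
    and V: "V2 \<subseteq> V1" and Q: "\<And>v. v \<in> V2 \<Longrightarrow> Re (Q1 v v) \<le> Re (Q2 v v)"
  shows "eig f q w N M1 n \<le> eig f q w N M2 n"
proof -
  interpret P1: sl_realization Q1 W V1 f q w N M1 by fact
  interpret P2: sl_realization Q2 W V2 f q w N M2 by fact
  let ?x = "eig f q w N M2 n"
  obtain S where S: "seq.subspace S" "S \<subseteq> V2" "seq.dim S = eig_count_le f q w N M2 ?x"
    "\<And>v. v \<in> S \<Longrightarrow> Re (Q2 v v) \<le> ?x * Re (W v v)"
    using P2.eig_count_attained[of ?x] by blast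
  have "n < eig_count_le f q w N M2 ?x" using P2.eig_le_iff[OF n(2), of ?x] by simp
  also have "\<dots> = seq.dim S" using S(3) by simp
  also have "\<dots> \<le> eig_count_le f q w N M1 ?x"
  proof (rule P1.dim_le_eig_count)
    show "Re (Q1 v v) \<le> ?x * Re (W v v)" if "v \<in> S" for v
      using that S(2) Q[of v] S(4)[of v] by auto
  qed (use S V in auto)
  finally show ?thesis using P1.eig_le_iff[OF n(1)] by simp
qed

text \<open>Cutting the witness of the second problem with the kernel of \<open>l\<close> costs at
  most one dimension, hence the shift of index. The forms are compared on that kernel only, so they
  may differ by any multiple of \<open>|l v|^2\<close>.\<close>

lemma eig_interlace:
  assumes 1: "sl_realization Q1 W V1 f q w N M1" and 2: "sl_realization Q2 W V2 f q w N M2"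
    and l: "Vector_Spaces.linear (\<lambda>c y n. c * y n) (*) l"
    and n: "n < seq.dim V1" "n + 1 < seq.dim V2"
    and V: "\<And>v. v \<in> V2 \<Longrightarrow> l v = 0 \<Longrightarrow> v \<in> V1"
    and Q: "\<And>v. v \<in> V2 \<Longrightarrow> l v = 0 \<Longrightarrow> Re (Q1 v v) \<le> Re (Q2 v v)"
  shows "eig f q w N M1 n \<le> eig f q w N M2 (n + 1)"
proof -
  interpret P1: sl_realization Q1 W V1 f q w N M1 by fact
  interpret P2: sl_realization Q2 W V2 f q w N M2 by fact
  interpret l: Vector_Spaces.linear "\<lambda>c y n. c * y n" "(*)" l by fact
  let ?x = "eig f q w N M2 (n + 1)"
  obtain S where S: "seq.subspace S" "S \<subseteq> V2" "seq.dim S = eig_count_le f q w N M2 ?x"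
    "\<And>v. v \<in> S \<Longrightarrow> Re (Q2 v v) \<le> ?x * Re (W v v)"
    using P2.eig_count_attained[of ?x] by blast
  let ?K = "{v \<in> S. l v = 0}"
  obtain T where T: "finite T" "V2 \<subseteq> seq.span T" using P2.finite_span by blast
  have "n + 1 < eig_count_le f q w N M2 ?x" using P2.eig_le_iff[OF n(2), of ?x] by simp
  also have "\<dots> = seq.dim S" using S(3) by simp
  also have "\<dots> \<le> seq.dim ?K + 1"
    using S T by (intro seq.dim_le_dim_kernel_plus_1[OF l]) auto
  also have "seq.dim ?K \<le> eig_count_le f q w N M1 ?x"
  proof (rule P1.dim_le_eig_count)
    show "seq.subspace ?K"
      using S(1) by (auto simp: seq.subspace_def l.add l.scale)
    show "?K \<subseteq> V1" using S(2) V by auto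
    show "Re (Q1 v v) \<le> ?x * Re (W v v)" if "v \<in> ?K" for v
      using that S(2) Q[of v] S(4)[of v] by auto
  qed
  finally show ?thesis using P1.eig_le_iff[OF n(1)] by simp
qed

section \<open>The quadratic form of the Sturm--Liouville problem\<close>

definition wform :: "(nat \<Rightarrow> real) \<Rightarrow> nat \<Rightarrow> (nat \<Rightarrow> complex) \<Rightarrow> (nat \<Rightarrow> complex) \<Rightarrow> complex" where
  "wform w N y v = (\<Sum>n=1..N. of_real (w n) * y n * cnj (v n))"

definition dirichlet_form ::
  "(nat \<Rightarrow> real) \<Rightarrow> nat \<Rightarrow> (nat \<Rightarrow> complex) \<Rightarrow> (nat \<Rightarrow> complex) \<Rightarrow> complex" where
  "dirichlet_form f N y v = (\<Sum>n=1..<N. of_real (f n) * (y (n+1) - y n) * cnj (v (n+1) - v n))"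

text \<open>With \<open>u = f 0 * (y 1 - y 0)\<close>, the first row of \<open>A(a12, b21)\<close> reads
  \<open>(1 / f 0 - a12) * u = y 1 + cnj z * y N\<close>. Eliminating \<open>u\<close> and \<open>f N * (y (N+1) - y N)\<close> leaves
  the form below with \<open>b = b21\<close> and \<open>c = 1 / (1 / f 0 - a12)\<close>.\<close>

definition qform :: "(nat \<Rightarrow> real) \<Rightarrow> (nat \<Rightarrow> real) \<Rightarrow> nat \<Rightarrow> complex \<Rightarrow> real \<Rightarrow> real
    \<Rightarrow> (nat \<Rightarrow> complex) \<Rightarrow> (nat \<Rightarrow> complex) \<Rightarrow> complex" where
  "qform f q N z b c y v = dirichlet_form f N y v + wform q N y v
     + of_real b * y N * cnj (v N)
     + of_real c * (y 1 + cnj z * y N) * cnj (v 1 + cnj z * v N)"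

lemma continuous_on_coordinate [continuous_intros]:
  "continuous_on S (\<lambda>y::nat \<Rightarrow> complex. y n)"
  by (rule continuous_on_subset[OF continuous_on_product_coordinates]) simp

lemma hermitian_form_wform: "hermitian_form (\<lambda>c y n. c * y n) (wform w N)"
proof
  show "wform w N (u + v) x = wform w N u x + wform w N v x" for u v x
    by (simp add: wform_def algebra_simps sum.distrib)
  show "wform w N (\<lambda>n. c * u n) x = c * wform w N u x" for c u x
    by (simp add: wform_def algebra_simps sum_distrib_left)
  show "wform w N x u = cnj (wform w N u x)" for x u
    by (simp add: wform_def algebra_simps)
  show "continuous_on UNIV (\<lambda>u. wform w N u x)" for x
    unfolding wform_def by (intro continuous_intros)
  show "continuous_on UNIV (\<lambda>u. wform w N u u)"
    unfolding wform_def by (intro continuous_intros)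
qed

lemma hermitian_form_dirichlet_form: "hermitian_form (\<lambda>c y n. c * y n) (dirichlet_form f N)"
proof
  show "dirichlet_form f N (u + v) x = dirichlet_form f N u x + dirichlet_form f N v x" for u v x
    unfolding dirichlet_form_def sum.distrib[symmetric] by (intro sum.cong) (auto simp: algebra_simps)
  show "dirichlet_form f N (\<lambda>n. c * u n) x = c * dirichlet_form f N u x" for c u x
    unfolding dirichlet_form_def sum_distrib_left by (intro sum.cong) (auto simp: algebra_simps)
  show "dirichlet_form f N x u = cnj (dirichlet_form f N u x)" for x u
    by (simp add: dirichlet_form_def algebra_simps)
  show "continuous_on UNIV (\<lambda>u. dirichlet_form f N u x)" for x
    unfolding dirichlet_form_def by (intro continuous_intros)
  show "continuous_on UNIV (\<lambda>u. dirichlet_form f N u u)"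
    unfolding dirichlet_form_def by (intro continuous_intros)
qed

lemma hermitian_form_qform: "hermitian_form (\<lambda>c y n. c * y n) (qform f q N z b c)"
proof -
  interpret d: hermitian_form "\<lambda>c y n. c * y n" "dirichlet_form f N"
    by (rule hermitian_form_dirichlet_form)
  interpret p: hermitian_form "\<lambda>c y n. c * y n" "wform q N"
    by (rule hermitian_form_wform)
  show ?thesis
  proof
    show "qform f q N z b c (u + v) x = qform f q N z b c u x + qform f q N z b c v x" for u v x
      by (simp add: qform_def d.add_left p.add_left algebra_simps)
    show "qform f q N z b c (\<lambda>n. k * u n) x = k * qform f q N z b c u x" for k u x
      by (simp add: qform_def d.scale_left p.scale_left algebra_simps)
    show "qform f q N z b c x u = cnj (qform f q N z b c u x)" for x u
      by (simp add: qform_def d.hermitian[of x u] p.hermitian[of x u] algebra_simps)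
    show "continuous_on UNIV (\<lambda>u. qform f q N z b c u x)" for x
      unfolding qform_def by (intro continuous_intros d.continuous_left p.continuous_left)
    show "continuous_on UNIV (\<lambda>u. qform f q N z b c u u)"
      unfolding qform_def by (intro continuous_intros d.continuous_diag p.continuous_diag)
  qed
qed

text \<open>The assumptions compare products, not coefficients, so that a vanishing
  \<open>v N\<close> or \<open>v 1 + cnj z * v N\<close> leaves the corresponding coefficients
  arbitrary.\<close>

lemma qform_diag_mono:
  assumes "b * (cmod (v N))\<^sup>2 \<le> b' * (cmod (v N))\<^sup>2"
    and "c * (cmod (v 1 + cnj z * v N))\<^sup>2 \<le> c' * (cmod (v 1 + cnj z * v N))\<^sup>2"
  shows "Re (qform f q N z b c v v) \<le> Re (qform f q N z b' c' v v)"
proof -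
  have *: "of_real r * t * cnj t = of_real (r * (cmod t)\<^sup>2)" for r t
    by (simp add: complex_norm_square mult.assoc del: of_real_power)
  show ?thesis using assms unfolding qform_def * by simp
qed

text \<open>The flags \<open>e\<close> and \<open>d\<close> switch on the two constraints that survive a boundary condition:
  \<open>e\<close> for \<open>a12 = 1 / f 0\<close>, \<open>d\<close> for the Dirichlet condition of \<open>S2\<close> at \<open>N\<close>.\<close>

definition vsp :: "nat \<Rightarrow> complex \<Rightarrow> bool \<Rightarrow> bool \<Rightarrow> (nat \<Rightarrow> complex) set" where
  "vsp N z e d = {y. (\<forall>n. n \<notin> {1..N} \<longrightarrow> y n = 0) \<and>
     (e \<longrightarrow> y 1 + cnj z * y N = 0) \<and> (d \<longrightarrow> y N = 0)}"

definition coord_vec :: "nat \<Rightarrow> nat \<Rightarrow> complex" where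
  "coord_vec k = (\<lambda>n. if n = k then 1 else 0)"

lemma vsp_transfer:
  assumes "v \<in> vsp N z e d" "e' \<Longrightarrow> v 1 + cnj z * v N = 0" "d' \<Longrightarrow> v N = 0"
  shows "v \<in> vsp N z e' d'"
  using assms by (simp add: vsp_def)

lemma subspace_vsp: "seq.subspace (vsp N z e d)"
proof -
  have "u 1 + v 1 + cnj z * (u N + v N) = 0"
    if "u 1 + cnj z * u N = 0" "v 1 + cnj z * v N = 0" for u v :: "nat \<Rightarrow> complex"
    using arg_cong2[where f = "(+)", OF that] by (simp add: algebra_simps)
  moreover have "k * u 1 + cnj z * (k * u N) = 0"
    if "u 1 + cnj z * u N = 0" for u :: "nat \<Rightarrow> complex" and k
    using arg_cong[OF that, of "\<lambda>t. k * t"] by (simp add: algebra_simps)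
  ultimately show ?thesis
    unfolding seq.subspace_def vsp_def by simp
qed

lemma sum_fun_apply: "(\<Sum>k\<in>A. g k) n = (\<Sum>k\<in>A. g k n)"
  for g :: "'i \<Rightarrow> 'b \<Rightarrow> 'c::comm_monoid_add"
  by (induction A rule: infinite_finite_induct) auto

lemma vsp_subset_span: "vsp N z e d \<subseteq> seq.span (coord_vec ` {1..N})"
proof
  fix y assume "y \<in> vsp N z e d"
  then have "y = (\<Sum>k\<in>{1..N}. (\<lambda>n. y k * coord_vec k n))"
    by (auto simp: fun_eq_iff sum_fun_apply coord_vec_def vsp_def if_distrib cong: if_cong)
  moreover have "(\<Sum>k\<in>{1..N}. (\<lambda>n. y k * coord_vec k n)) \<in> seq.span (coord_vec ` {1..N})"
    by (intro seq.span_sum seq.span_scale seq.span_base) auto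
  ultimately show "y \<in> seq.span (coord_vec ` {1..N})" by simp
qed

lemma linear_functional:
  assumes "\<And>u v. l (u + v) = l u + l v" "\<And>k u. l (\<lambda>n. k * u n) = k * l u"
  shows "Vector_Spaces.linear (\<lambda>(k::complex) (y::nat \<Rightarrow> complex) n. k * y n) (*) l"
proof -
  interpret m: vector_space "(*) :: complex \<Rightarrow> complex \<Rightarrow> complex"
    by unfold_locales (simp_all add: algebra_simps)
  show ?thesis by unfold_locales (simp_all add: assms)
qed

lemma linear_coordinate: "Vector_Spaces.linear (\<lambda>(k::complex) (y::nat \<Rightarrow> complex) n. k * y n) (*) (\<lambda>y. y k)"
  by (rule linear_functional) auto

lemma linear_constraint:
  "Vector_Spaces.linear (\<lambda>(k::complex) (y::nat \<Rightarrow> complex) n. k * y n) (*) (\<lambda>y. y 1 + cnj z * y N)"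
  by (rule linear_functional) (auto simp: algebra_simps)

text \<open>Each constraint is a functional that is nonzero on the space it cuts. For the constraint
  \<open>e\<close> the witness is \<open>coord_vec 1\<close>, which also satisfies \<open>d\<close>
  because \<open>N\<close> differs from 1.\<close>

lemma dim_vsp:
  assumes "N \<ge> 2"
  shows "seq.dim (vsp N z e d) = N - of_bool e - of_bool d"
proof -
  have full: "seq.dim (vsp k z False False) = k" for k
  proof (induction k)
    case 0
    have "vsp 0 z False False \<subseteq> seq.span {}" by (auto simp: vsp_def fun_eq_iff)
    then show ?case using seq.dim_le_card[of _ "{}"] by fastforce
  next
    case (Suc k)
    have "seq.dim (vsp (Suc k) z False False) = seq.dim {x \<in> vsp (Suc k) z False False. x (Suc k) = 0} + 1"
      by (rule seq.dim_eq_dim_kernel_plus_1[OF linear_coordinate subspace_vsp vsp_subset_span, of _ "coord_vec (Suc k)"])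
        (auto simp: vsp_def coord_vec_def)
    also have "{x \<in> vsp (Suc k) z False False. x (Suc k) = 0} = vsp k z False False"
      by (auto simp: vsp_def) (metis le_SucE)
    finally show ?case using Suc.IH by simp
  qed
  have d: "seq.dim (vsp N z False True) = N - 1"
  proof -
    have "seq.dim (vsp N z False False) = seq.dim {x \<in> vsp N z False False. x N = 0} + 1"
      by (rule seq.dim_eq_dim_kernel_plus_1[OF linear_coordinate subspace_vsp vsp_subset_span, of _ "coord_vec N"])
        (use assms in \<open>auto simp: vsp_def coord_vec_def\<close>)
    also have "{x \<in> vsp N z False False. x N = 0} = vsp N z False True"
      by (auto simp: vsp_def)
    finally show ?thesis by (simp add: full)
  qed
  have e: "seq.dim (vsp N z False d) = seq.dim (vsp N z True d) + 1"
  proof -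
    have "seq.dim (vsp N z False d) = seq.dim {x \<in> vsp N z False d. x 1 + cnj z * x N = 0} + 1"
      by (rule seq.dim_eq_dim_kernel_plus_1[OF linear_constraint subspace_vsp vsp_subset_span, of _ "coord_vec 1"])
        (use assms in \<open>auto simp: vsp_def coord_vec_def\<close>)
    also have "{x \<in> vsp N z False d. x 1 + cnj z * x N = 0} = vsp N z True d"
      by (auto simp: vsp_def)
    finally show ?thesis .
  qed
  show ?thesis using e full[of N] d by (cases e; cases d) auto
qed

lemma wform_diag: "Re (wform w N v v) = (\<Sum>n=1..N. w n * (cmod (v n))\<^sup>2)"
proof -
  have *: "of_real r * t * cnj t = of_real (r * (cmod t)\<^sup>2)" for r t
    by (simp add: complex_norm_square mult.assoc del: of_real_power)
  show ?thesis unfolding wform_def * by simp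
qed

lemma hermitian_pencil_vsp:
  assumes hw: "\<forall>n\<in>{1..N}. w n > 0"
  shows "hermitian_pencil (\<lambda>c y n. c * y n) (qform f q N z b c) (wform w N) (vsp N z e d)"
proof -
  interpret Q: hermitian_form "\<lambda>c y n. c * y n" "qform f q N z b c" by (rule hermitian_form_qform)
  interpret W: hermitian_form "\<lambda>c y n. c * y n" "wform w N" by (rule hermitian_form_wform)
  have nonneg: "0 \<le> w n * (cmod (v n))\<^sup>2" if "n \<in> {1..N}" for n v
    using hw that by (intro mult_nonneg_nonneg) (auto simp: less_imp_le)
  show ?thesis
  proof
    show "seq.subspace (vsp N z e d)" by (rule subspace_vsp)
    show "\<exists>T. finite T \<and> vsp N z e d \<subseteq> seq.span T" using vsp_subset_span by blast
  next
    fix v assume v: "v \<in> vsp N z e d" "v \<noteq> 0"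
    then obtain n where n: "n \<in> {1..N}" "v n \<noteq> 0" by (auto simp: vsp_def fun_eq_iff)
    then have "0 < w n * (cmod (v n))\<^sup>2" using hw by simp
    also have "\<dots> \<le> (\<Sum>n=1..N. w n * (cmod (v n))\<^sup>2)"
      using n nonneg by (intro member_le_sum) auto
    finally show "Re (wform w N v v) > 0" by (simp add: wform_diag)
  next
    \<comment> \<open>On the unit sphere \<open>w n * |v n|^2\<close> is at most 1, which gives
      these radii. The sphere is then a closed subset of a product of discs and points, compact by
      Tychonoff.\<close>
    define K where "K n = (if n \<in> {1..N} then cball (0::complex) (1 / sqrt (w n)) else {0})" for n
    have "compactin (product_topology (\<lambda>n. euclidean) UNIV) (PiE UNIV K)"
      by (subst compactin_PiE) (auto simp: K_def)
    then have cK: "compact (PiE UNIV K)"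
      by (simp add: euclidean_product_topology)
    define D where "D = {y::nat \<Rightarrow> complex. (e \<longrightarrow> y 1 + cnj z * y N = 0) \<and> (d \<longrightarrow> y N = 0)
      \<and> Re (wform w N y y) = 1}"
    have "closed D" unfolding D_def
      by (intro closed_Collect_conj closed_Collect_imp closed_Collect_eq open_Collect_const
          continuous_intros W.continuous_diag)
    have "v \<in> PiE UNIV K" if v: "\<forall>n. n \<notin> {1..N} \<longrightarrow> v n = 0" "Re (wform w N v v) = 1" for v
    proof -
      have "v n \<in> K n" for n
      proof (cases "n \<in> {1..N}")
        case True
        have "w n * (cmod (v n))\<^sup>2 \<le> (\<Sum>n=1..N. w n * (cmod (v n))\<^sup>2)"
          using True nonneg by (intro member_le_sum) auto
        then have "(cmod (v n))\<^sup>2 \<le> 1 / w n"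
          using v(2) hw True by (simp add: wform_diag field_simps)
        then have "cmod (v n) \<le> sqrt (1 / w n)" by (rule real_le_rsqrt)
        then show ?thesis using True by (simp add: K_def real_sqrt_divide)
      qed (use v in \<open>auto simp: K_def\<close>)
      then show ?thesis by auto
    qed
    moreover have "v n = 0" if "v \<in> PiE UNIV K" "n \<notin> {1..N}" for v n
      using that(2) PiE_mem[OF that(1), of n] by (simp add: K_def split: if_splits)
    ultimately have "{v \<in> vsp N z e d. Re (wform w N v v) = 1} = PiE UNIV K \<inter> D"
      unfolding vsp_def D_def by blast
    then show "compact {v \<in> vsp N z e d. Re (wform w N v v) = 1}"
      using compact_Int_closed[OF cK \<open>closed D\<close>] by simp
  qed
qed

section \<open>From the difference equation to its weak form\<close>

definition residual :: "(nat \<Rightarrow> real) \<Rightarrow> (nat \<Rightarrow> real) \<Rightarrow> (nat \<Rightarrow> real) \<Rightarrow> complex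
    \<Rightarrow> (nat \<Rightarrow> complex) \<Rightarrow> nat \<Rightarrow> complex" where
  "residual f q w l y n =
     - (of_real (f n) * (y (n+1) - y n) - of_real (f (n-1)) * (y n - y (n-1)))
     + of_real (q n) * y n - l * of_real (w n) * y n"

lemma sl_eq_iff_residual: "sl_eq f q w N l y \<longleftrightarrow> (\<forall>n\<in>{1..N}. residual f q w l y n = 0)"
  by (auto simp: sl_eq_def residual_def)

lemma summation_by_parts:
  fixes g v :: "nat \<Rightarrow> complex"
  assumes "N \<ge> 1"
  shows "(\<Sum>n=1..N. - (g n - g (n-1)) * v n) =
    (\<Sum>n=1..<N. g n * (v (n+1) - v n)) + g 0 * v 1 - g N * v N"
  using assms by (induction N rule: dec_induct) (simp_all add: algebra_simps)

text \<open>The boundary terms of summation by parts, minus those already absorbed in \<open>qform\<close>;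
  \<open>u\<close> and \<open>g\<close> stand for \<open>f 0 * (y 1 - y 0)\<close> and \<open>f N * (y (N+1) - y N)\<close>.\<close>

definition boundary_form :: "complex \<Rightarrow> real \<Rightarrow> real \<Rightarrow> complex \<Rightarrow> complex
    \<Rightarrow> complex \<Rightarrow> complex \<Rightarrow> complex \<Rightarrow> complex \<Rightarrow> complex" where
  "boundary_form z b c u g y1 yN v1 vN = u * cnj v1 - g * cnj vN - of_real b * yN * cnj vN
     - of_real c * (y1 + cnj z * yN) * cnj (v1 + cnj z * vN)"

text \<open>The terms with \<open>b\<close> and \<open>c\<close> are added in \<open>qform\<close>
  and removed in \<open>boundary_form\<close>, so this is summation by parts for arbitrary
  \<open>b\<close> and \<open>c\<close>. A boundary condition enters only by making
  \<open>boundary_form\<close> vanish.\<close>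

lemma sum_residual:
  assumes "N \<ge> 1"
  shows "(\<Sum>n=1..N. residual f q w l y n * cnj (v n)) =
    qform f q N z b c y v - l * wform w N y v
    + boundary_form z b c (of_real (f 0) * (y 1 - y 0)) (of_real (f N) * (y (N+1) - y N))
        (y 1) (y N) (v 1) (v N)"
proof -
  let ?g = "\<lambda>n. of_real (f n) * (y (n+1) - y n)"
  have "(\<Sum>n=1..N. residual f q w l y n * cnj (v n)) =
      (\<Sum>n=1..N. - (?g n - ?g (n-1)) * cnj (v n)
         + (of_real (q n) * y n * cnj (v n) - l * (of_real (w n) * y n * cnj (v n))))"
    by (intro sum.cong) (auto simp: residual_def algebra_simps)
  also have "\<dots> = (\<Sum>n=1..N. - (?g n - ?g (n-1)) * cnj (v n))
      + (wform q N y v - l * wform w N y v)"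
    by (simp only: sum.distrib sum_subtractf wform_def sum_distrib_left)
  also have "(\<Sum>n=1..N. - (?g n - ?g (n-1)) * cnj (v n)) =
      dirichlet_form f N y v + ?g 0 * cnj (v 1) - ?g N * cnj (v N)"
    by (subst summation_by_parts[OF assms, of ?g "\<lambda>n. cnj (v n)"]) (simp add: dirichlet_form_def)
  finally show ?thesis by (simp add: qform_def boundary_form_def)
qed

lemma wform_restr: "wform w N (restr N y) v = wform w N y v"
  unfolding wform_def by (intro sum.cong) (auto simp: restr_def)

lemma qform_restr:
  assumes "N \<ge> 2"
  shows "qform f q N z b c (restr N y) v = qform f q N z b c y v"
proof -
  have "dirichlet_form f N (restr N y) v = dirichlet_form f N y v"
    unfolding dirichlet_form_def by (intro sum.cong) (auto simp: restr_def)
  moreover have "restr N y 1 = y 1" "restr N y N = y N"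
    using assms by (auto simp: restr_def)
  ultimately show ?thesis unfolding qform_def wform_restr by simp
qed

text \<open>Where a constraint is imposed, the corresponding boundary value is a Lagrange multiplier: \<open>bwd\<close>
  demands that \<open>u\<close> (resp. \<open>g\<close>) may be prescribed freely, so that the first (resp. last) row of the
  equation, which the constrained test vectors do not see, can be satisfied.\<close>

lemma sl_realizationI:
  assumes hN: "N \<ge> 2" and hf: "\<forall>n\<le>N. f n \<noteq> 0" and hw: "\<forall>n\<in>{1..N}. w n > 0"
    and fwd: "\<And>y. bc_holds M f N y \<Longrightarrow> (e \<longrightarrow> y 1 + cnj z * y N = 0) \<and> (d \<longrightarrow> y N = 0) \<and>
      (\<forall>v1 vN. (e \<longrightarrow> v1 + cnj z * vN = 0) \<longrightarrow> (d \<longrightarrow> vN = 0) \<longrightarrow>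
        boundary_form z b c (of_real (f 0) * (y 1 - y 0)) (of_real (f N) * (y (N+1) - y N))
          (y 1) (y N) v1 vN = 0)"
    and bwd: "\<And>x1 xN r s. (e \<longrightarrow> x1 + cnj z * xN = 0) \<Longrightarrow> (d \<longrightarrow> xN = 0) \<Longrightarrow>
      \<exists>u g. (\<forall>i<2. M i 0 * (x1 - u / of_real (f 0)) + M i 1 * u + M i 2 * xN + M i 3 * g = 0) \<and>
        (e \<longrightarrow> u = r) \<and> (d \<longrightarrow> g = s) \<and>
        (\<forall>v1 vN. (e \<longrightarrow> v1 + cnj z * vN = 0) \<longrightarrow> (d \<longrightarrow> vN = 0) \<longrightarrow>
          boundary_form z b c u g x1 xN v1 vN = 0)"
  shows "sl_realization (qform f q N z b c) (wform w N) (vsp N z e d) f q w N M"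
proof -
  let ?V = "vsp N z e d"
  interpret hermitian_pencil "\<lambda>c y n. c * y n" "qform f q N z b c" "wform w N" ?V
    using hw by (rule hermitian_pencil_vsp)
  have vV: "(e \<longrightarrow> v 1 + cnj z * v N = 0) \<and> (d \<longrightarrow> v N = 0)" if "v \<in> ?V" for v
    using that by (simp add: vsp_def)
  have "restr N y \<in> eigenspace l" if y: "y \<in> sol_space f q w N M l" for y l
  proof -
    have sl: "\<forall>n\<in>{1..N}. residual f q w l y n = 0" and bc: "bc_holds M f N y"
      using y by (auto simp: sol_space_def sl_eq_iff_residual)
    have "restr N y 1 = y 1" "restr N y N = y N" using hN by (auto simp: restr_def)
    then have "restr N y \<in> ?V" using fwd[OF bc] by (auto simp: vsp_def) (auto simp: restr_def)
    moreover have "qform f q N z b c y v = l * wform w N y v" if v: "v \<in> ?V" for v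
    proof -
      have "(\<Sum>n=1..N. residual f q w l y n * cnj (v n)) = 0"
        using sl by (intro sum.neutral) simp
      then show ?thesis
        using sum_residual[of N f q w l y v z b c] hN fwd[OF bc] vV[OF v] by simp
    qed
    ultimately show ?thesis
      unfolding eigenspace_def by (simp add: wform_restr qform_restr[OF hN])
  qed
  moreover have "x \<in> restr N ` sol_space f q w N M l" if x: "x \<in> eigenspace l" for x l
  proof -
    have xV: "x \<in> ?V" using x by (simp add: eigenspace_def)
    then have x0: "x n = 0" if "n \<notin> {1..N}" for n using that by (simp add: vsp_def)
    \<comment> \<open>\<open>r\<close> and \<open>s\<close> are the values of
      \<open>f 0 * (y 1 - y 0)\<close> and \<open>f N * (y (N+1) - y N)\<close> forced by the rows 1
      and \<open>N\<close>.\<close>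
    define r where "r = of_real (f 1) * (x 2 - x 1) - of_real (q 1) * x 1 + l * of_real (w 1) * x 1"
    define s where "s = of_real (f (N-1)) * (x N - x (N-1)) + of_real (q N) * x N - l * of_real (w N) * x N"
    obtain u g where bc: "\<forall>i<2. M i 0 * (x 1 - u / of_real (f 0)) + M i 1 * u + M i 2 * x N + M i 3 * g = 0"
      and u: "e \<longrightarrow> u = r" and g: "d \<longrightarrow> g = s"
      and bdry: "\<And>v1 vN. (e \<longrightarrow> v1 + cnj z * vN = 0) \<Longrightarrow> (d \<longrightarrow> vN = 0) \<Longrightarrow>
          boundary_form z b c u g (x 1) (x N) v1 vN = 0"
      using bwd[of "x 1" "x N" r s] vV[OF xV] by blast
    \<comment> \<open>The endpoint values are chosen to realise the prescribed boundary differences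
      \<open>u\<close> and \<open>g\<close>.\<close>
    define y where "y = x(0 := x 1 - u / of_real (f 0), N+1 := x N + g / of_real (f N))"
    have yx: "y n = x n" if "n \<in> {1..N}" for n using that by (simp add: y_def)
    have y1: "y 1 = x 1" and yN: "y N = x N" and y2: "y 2 = x 2" and yN1: "y (N-1) = x (N-1)"
      using hN yx by auto
    have y0: "of_real (f 0) * (y 1 - y 0) = u" and yS: "of_real (f N) * (y (N+1) - y N) = g"
      using hf unfolding y1 yN by (auto simp: y_def)
    have ry: "restr N y = x" using yx x0 by (auto simp: restr_def fun_eq_iff)
    have test: "(\<Sum>n=1..N. residual f q w l y n * cnj (v n)) = 0" if v: "v \<in> ?V" for v
    proof -
      have "qform f q N z b c y v = l * wform w N y v"
        using x v unfolding eigenspace_def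
        by (simp add: ry flip: qform_restr[OF hN, of f q z b c y] wform_restr[of w N y])
      then show ?thesis
        using sum_residual[of N f q w l y v z b c] hN bdry[of "v 1" "v N"] vV[OF v]
        unfolding y0 yS unfolding y1 yN by simp
    qed
    \<comment> \<open>A coordinate vector that meets the constraints isolates one row of the
      equation.\<close>
    have test_coord: "residual f q w l y k = 0" if "k \<in> {1..N}" "coord_vec k \<in> ?V" for k
      using test[OF that(2)] that(1) by (simp add: coord_vec_def if_distrib cong: if_cong)
    have res1: "residual f q w l y 1 = 0"
    proof (cases e)
      case True
      have "residual f q w l y 1 = of_real (f 0) * (y 1 - y 0) - r"
        unfolding residual_def r_def y1[symmetric] y2[symmetric] by (simp add: numeral_2_eq_2 algebra_simps)
      then show ?thesis using u True y0 by simp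
    next
      case False
      then show ?thesis using hN by (intro test_coord) (auto simp: vsp_def coord_vec_def)
    qed
    have resN: "residual f q w l y N = 0"
    proof (cases d)
      case True
      have "residual f q w l y N = s - of_real (f N) * (y (N+1) - y N)"
        unfolding residual_def s_def yN[symmetric] yN1[symmetric] by (simp add: algebra_simps)
      then show ?thesis using g True yS by simp
    next
      case False
      \<comment> \<open>\<open>coord_vec N\<close> may violate the constraint \<open>e\<close>; the
        correction at 1 restores it and brings in only the residual of row 1, already known to
        vanish.\<close>
      let ?v = "\<lambda>n. coord_vec N n - cnj z * coord_vec 1 n"
      have "?v \<in> ?V" using False hN by (auto simp: vsp_def coord_vec_def)
      then have "0 = (\<Sum>n=1..N. residual f q w l y n * cnj (?v n))" by (rule test[symmetric])
      also have "\<dots> = (\<Sum>n=1..N. residual f q w l y n * coord_vec N n - z * (residual f q w l y n * coord_vec 1 n))"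
        by (intro sum.cong) (auto simp: coord_vec_def algebra_simps)
      also have "\<dots> = residual f q w l y N - z * residual f q w l y 1"
        unfolding sum_subtractf sum_distrib_left[symmetric]
        using hN by (simp add: coord_vec_def if_distrib cong: if_cong)
      finally show ?thesis using res1 by simp
    qed
    have "residual f q w l y n = 0" if n: "n \<in> {1..N}" for n
    proof -
      consider "n = 1" | "n = N" | "n \<noteq> 1" "n \<noteq> N" by blast
      then show ?thesis
      proof cases
        case 3
        then show ?thesis using n by (intro test_coord) (auto simp: vsp_def coord_vec_def)
      qed (use res1 resN in auto)
    qed
    then have "sl_eq f q w N l y" by (simp add: sl_eq_iff_residual)
    moreover have "bc_holds M f N y"
      using bc unfolding bc_holds_def y0 yS unfolding yN by (simp add: y_def)
    moreover have "\<forall>n>N+1. y n = 0" using x0 by (simp add: y_def)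
    ultimately have "y \<in> sol_space f q w N M l" by (simp add: sol_space_def)
    then show ?thesis using ry by blast
  qed
  ultimately have "restr N ` sol_space f q w N M l = eigenspace l" for l by blast
  moreover have "inj_on (restr N) (sol_space f q w N M l)" for l
    by (rule inj_on_restr_sol_space[OF hN hf])
  ultimately show ?thesis
    by unfold_locales auto
qed

lemma all_less_2: "(\<forall>i<2. P i) \<longleftrightarrow> P 0 \<and> P (1::nat)"
  by (auto simp: numeral_2_eq_2 less_Suc_eq)

section \<open>The boundary conditions\<close>

context
  fixes f q w :: "nat \<Rightarrow> real" and N :: nat and z :: complex
  assumes hN: "N \<ge> 2"
    and hf: "\<forall>n\<le>N. f n \<noteq> 0"
    and hw: "\<forall>n\<in>{1..N}. w n > 0"
begin

lemma realization_A_generic: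
  assumes a: "a \<noteq> 1 / f 0"
  shows "sl_realization (qform f q N z b (1 / (1 / f 0 - a))) (wform w N) (vsp N z False False)
    f q w N (bcA a b z)"
proof -
  define k :: complex where "k = of_real (1 / f 0 - a)"
  have k: "k \<noteq> 0" "of_real (1 / (1 / f 0 - a)) = 1 / k"
    unfolding k_def of_real_eq_0_iff using a by simp_all
  have kid: "x - u / of_real (f 0) + of_real a * u = x - k * u" for x u
    by (simp add: k_def left_diff_distrib)
  have f0: "f 0 \<noteq> 0" using hf by simp
  \<comment> \<open>With this \<open>g\<close> the \<open>b\<close> terms cancel, and
    \<open>u * cnj (v1 + cnj z * vN)\<close> remains against the same expression multiplied by
    \<open>c * k = 1\<close>.\<close>
  have bdry: "boundary_form z b (1 / (1 / f 0 - a)) u (- z * u - of_real b * yN) y1 yN v1 vN = 0"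
    if "y1 + cnj z * yN = k * u" for u y1 yN v1 vN
    unfolding boundary_form_def k(2) that using k(1) by (simp add: algebra_simps)
  show ?thesis
  proof (rule sl_realizationI[OF hN hf hw], goal_cases)
    case (1 y)
    define u where "u = of_real (f 0) * (y 1 - y 0)"
    define g where "g = of_real (f N) * (y (N+1) - y N)"
    have 1: "y 0 + of_real a * u + cnj z * y N = 0" and 2: "z * u + of_real b * y N + g = 0"
      using 1 by (simp_all add: bc_holds_def all_less_2 bcA_def u_def g_def)
    have "y 1 = y 0 + u / of_real (f 0)" using f0 by (simp add: u_def)
    then have "y 1 + cnj z * y N = (y 0 + of_real a * u + cnj z * y N) + k * u"
      by (simp add: k_def algebra_simps)
    then have "y 1 + cnj z * y N = k * u" using 1 by simp
    moreover have "g = - z * u - of_real b * y N" using 2 by algebra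
    ultimately show ?case using bdry unfolding u_def[symmetric] g_def[symmetric] by simp
  next
    case (2 x1 xN r s)
    let ?u = "(x1 + cnj z * xN) / k"
    have "x1 - ?u / of_real (f 0) + of_real a * ?u + cnj z * xN = 0"
      unfolding kid using k(1) by simp
    then show ?case
      using bdry[of x1 xN ?u] k(1)
      by (rule_tac exI[of _ ?u], rule_tac exI[of _ "- z * ?u - of_real b * xN"]) (simp add: all_less_2 bcA_def)
  qed
qed

text \<open>Now \<open>y 0 + a * u\<close> is just \<open>y 1\<close>, so the first row becomes the
  constraint and leaves \<open>u\<close> free. The boundary form is
  \<open>u * cnj (v1 + cnj z * vN)\<close>, zero on constrained test vectors.\<close>

lemma realization_A_degenerate:
  "sl_realization (qform f q N z b 0) (wform w N) (vsp N z True False) f q w N (bcA (1 / f 0) b z)"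
proof -
  have f0: "f 0 \<noteq> 0" using hf by simp
  have bdry: "boundary_form z b 0 u (- z * u - of_real b * yN) y1 yN v1 vN = 0"
    if "v1 + cnj z * vN = 0" for u y1 yN v1 vN
  proof -
    have "boundary_form z b 0 u (- z * u - of_real b * yN) y1 yN v1 vN = u * cnj (v1 + cnj z * vN)"
      by (simp add: boundary_form_def algebra_simps)
    then show ?thesis unfolding that by simp
  qed
  show ?thesis
  proof (rule sl_realizationI[OF hN hf hw], goal_cases)
    case (1 y)
    define u where "u = of_real (f 0) * (y 1 - y 0)"
    define g where "g = of_real (f N) * (y (N+1) - y N)"
    have 1: "y 0 + of_real (1 / f 0) * u + cnj z * y N = 0" and 2: "z * u + of_real b * y N + g = 0"
      using 1 by (simp_all add: bc_holds_def all_less_2 bcA_def u_def g_def)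
    have "y 1 = y 0 + of_real (1 / f 0) * u" using f0 by (simp add: u_def)
    then have "y 1 + cnj z * y N = 0" using 1 by simp
    moreover have "g = - z * u - of_real b * y N" using 2 by algebra
    ultimately show ?case using bdry unfolding u_def[symmetric] g_def[symmetric] by simp
  next
    case (2 x1 xN r s)
    then show ?case
      using bdry
      by (rule_tac exI[of _ r], rule_tac exI[of _ "- z * r - of_real b * xN"]) (simp add: all_less_2 bcA_def)
  qed
qed

text \<open>The first row forces \<open>u = 0\<close>, which removes the last term of the form
  without constraining the space.\<close>

lemma realization_S1:
  "sl_realization (qform f q N z b 0) (wform w N) (vsp N z False False) f q w N (bcS1 b)"
proof -
  show ?thesis
  proof (rule sl_realizationI[OF hN hf hw], goal_cases)
    case (1 y)
    define u where "u = of_real (f 0) * (y 1 - y 0)"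
    define g where "g = of_real (f N) * (y (N+1) - y N)"
    have "u = 0" and 2: "of_real b * y N + g = 0"
      using 1 by (simp_all add: bc_holds_def all_less_2 bcS1_def u_def g_def)
    moreover have "g = - of_real b * y N" using 2 by algebra
    ultimately show ?case unfolding u_def[symmetric] g_def[symmetric]
      by (simp add: boundary_form_def)
  next
    case (2 x1 xN r s)
    show ?case
      by (rule exI[of _ 0], rule exI[of _ "- of_real b * xN"])
        (simp add: all_less_2 bcS1_def boundary_form_def)
  qed
qed

text \<open>The parameter \<open>b\<close> is arbitrary because its term vanishes where
  \<open>y N = 0\<close>; comparisons can choose it to match the other problem.\<close>

lemma realization_S2_generic:
  assumes a: "a \<noteq> 1 / f 0"
  shows "sl_realization (qform f q N z b (1 / (1 / f 0 - a))) (wform w N) (vsp N z False True)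
    f q w N (bcS2 a)"
proof -
  define k :: complex where "k = of_real (1 / f 0 - a)"
  have k: "k \<noteq> 0" "of_real (1 / (1 / f 0 - a)) = 1 / k"
    unfolding k_def of_real_eq_0_iff using a by simp_all
  have kid: "x - u / of_real (f 0) + of_real a * u = x - k * u" for x u
    by (simp add: k_def left_diff_distrib)
  have f0: "f 0 \<noteq> 0" using hf by simp
  have bdry: "boundary_form z b (1 / (1 / f 0 - a)) u g (k * u) 0 v1 0 = 0" for u g v1
    unfolding boundary_form_def k(2) using k(1) by simp
  show ?thesis
  proof (rule sl_realizationI[OF hN hf hw], goal_cases)
    case (1 y)
    define u where "u = of_real (f 0) * (y 1 - y 0)"
    have 1: "y 0 + of_real a * u = 0" and 2: "y N = 0"
      using 1 by (simp_all add: bc_holds_def all_less_2 bcS2_def u_def)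
    have "y 1 = y 0 + u / of_real (f 0)" using f0 by (simp add: u_def)
    then have "y 1 = (y 0 + of_real a * u) + k * u"
      by (simp add: k_def algebra_simps)
    then have "y 1 = k * u" using 1 by simp
    then show ?case using bdry 2 unfolding u_def[symmetric] by simp
  next
    case (2 x1 xN r s)
    have "x1 - (x1 / k) / of_real (f 0) + of_real a * (x1 / k) = 0"
      unfolding kid using k(1) by simp
    then show ?case
      using bdry[of "x1 / k" s] k(1) 2
      by (rule_tac exI[of _ "x1 / k"], rule_tac exI[of _ s]) (simp add: all_less_2 bcS2_def)
  qed
qed

text \<open>The two constraints leave only test values \<open>v1 = vN = 0\<close>, so
  \<open>u\<close> and \<open>g\<close> are both free multipliers.\<close>

lemma realization_S2_degenerate:
  "sl_realization (qform f q N z b 0) (wform w N) (vsp N z True True) f q w N (bcS2 (1 / f 0))"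
proof -
  have f0: "f 0 \<noteq> 0" using hf by simp
  show ?thesis
  proof (rule sl_realizationI[OF hN hf hw], goal_cases)
    case (1 y)
    define u where "u = of_real (f 0) * (y 1 - y 0)"
    have 1: "y 0 + of_real (1 / f 0) * u = 0" and 2: "y N = 0"
      using 1 by (simp_all add: bc_holds_def all_less_2 bcS2_def u_def)
    have "y 1 = y 0 + of_real (1 / f 0) * u" using f0 by (simp add: u_def)
    then have "y 1 = 0" using 1 by simp
    then show ?case using 2 by (auto simp: boundary_form_def)
  next
    case (2 x1 xN r s)
    then show ?case
      by (rule_tac exI[of _ r], rule_tac exI[of _ s]) (auto simp: all_less_2 bcS2_def boundary_form_def)
  qed
qed

text \<open>For \<open>a = 1 / f 0\<close> the coefficient \<open>1 / (1 / f 0 - a)\<close> is the junk value \<open>1 / 0 = 0\<close>,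
  which is harmless: the form is then restricted to the subspace where its last term vanishes.\<close>

lemma realization_A:
  "sl_realization (qform f q N z b (1 / (1 / f 0 - a))) (wform w N) (vsp N z (a = 1 / f 0) False)
    f q w N (bcA a b z)"
  using realization_A_generic[where a = a and b = b] realization_A_degenerate[where b = b] by (cases "a = 1 / f 0") simp_all

lemma realization_S2:
  "sl_realization (qform f q N z b (1 / (1 / f 0 - a))) (wform w N) (vsp N z (a = 1 / f 0) True)
    f q w N (bcS2 a)"
  using realization_S2_generic[where a = a and b = b] realization_S2_degenerate[where b = b] by (cases "a = 1 / f 0") simp_all

text \<open>The map from \<open>a\<close> to \<open>1 / (1 / f 0 - a)\<close> increases on each side
  of the pole, from 0 to infinity on the left and from minus infinity to 0 on the right;
  \<open>S1\<close> is the value 0 between. This orders the problems as \<open>a3\<close>,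
  \<open>a4\<close>, \<open>S1\<close>, \<open>a1\<close>, \<open>a2\<close>. The return from
  \<open>a2\<close> to \<open>a3\<close> costs one index, as the forms agree on the hyperplane
  \<open>v 1 + cnj z * v N = 0\<close>.\<close>

lemma interlacing_a12:
  assumes a: "a1 < a2" "a2 \<le> 1 / f 0" "1 / f 0 < a3" "a3 < a4"
  shows "n < N \<Longrightarrow> eig f q w N (bcA a3 b z) n \<le> eig f q w N (bcA a4 b z) n"
    and "n < N \<Longrightarrow> eig f q w N (bcA a4 b z) n \<le> eig f q w N (bcS1 b) n"
    and "n < N \<Longrightarrow> eig f q w N (bcS1 b) n \<le> eig f q w N (bcA a1 b z) n"
    and "n < N - of_bool (a2 = 1 / f 0) \<Longrightarrow> eig f q w N (bcA a1 b z) n \<le> eig f q w N (bcA a2 b z) n"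
    and "n < N - 1 \<Longrightarrow> eig f q w N (bcA a2 b z) n \<le> eig f q w N (bcA a3 b z) (n + 1)"
proof -
  let ?c = "\<lambda>a. 1 / (1 / f 0 - a)"
  have c: "?c a3 \<le> ?c a4" "?c a4 \<le> 0" "0 \<le> ?c a1"
  proof -
    \<comment> \<open>The sign of \<open>f 0\<close> is irrelevant; only the position of each
      \<open>a\<close> relative to \<open>1 / f 0\<close> counts.\<close>
    define t where "t = 1 / f 0"
    show "1 / (1 / f 0 - a3) \<le> 1 / (1 / f 0 - a4)" "1 / (1 / f 0 - a4) \<le> 0" "0 \<le> 1 / (1 / f 0 - a1)"
      using a unfolding t_def[symmetric] by (auto simp: divide_simps)
  qed
  note A = realization_A[where b = b] and S1 = realization_S1[where b = b]
  note mono = qform_diag_mono[OF order_refl mult_right_mono[OF _ zero_le_power2]]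
  have ne: "a3 \<noteq> 1 / f 0" "a4 \<noteq> 1 / f 0" "a1 \<noteq> 1 / f 0" using a by auto
  show "eig f q w N (bcA a3 b z) n \<le> eig f q w N (bcA a4 b z) n" if "n < N"
    using that c(1) ne by (intro eig_mono[OF A A] mono) (auto simp: dim_vsp[OF hN])
  show "eig f q w N (bcA a4 b z) n \<le> eig f q w N (bcS1 b) n" if "n < N"
    using that c(2) ne by (intro eig_mono[OF A S1] mono) (auto simp: dim_vsp[OF hN])
  show "eig f q w N (bcS1 b) n \<le> eig f q w N (bcA a1 b z) n" if "n < N"
    using that c(3) ne by (intro eig_mono[OF S1 A] mono) (auto simp: dim_vsp[OF hN])
  show "eig f q w N (bcA a1 b z) n \<le> eig f q w N (bcA a2 b z) n" if n: "n < N - of_bool (a2 = 1 / f 0)"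
  proof (rule eig_mono[OF A A])
    fix v assume v: "v \<in> vsp N z (a2 = 1 / f 0) False"
    show "Re (qform f q N z b (?c a1) v v) \<le> Re (qform f q N z b (?c a2) v v)"
    \<comment> \<open>At the pole the coefficient carries no information, but the space has shrunk
      to the hyperplane, where the two forms coincide. Otherwise both coefficients are positive and
      ordered.\<close>
    proof (cases "a2 = 1 / f 0")
      case True
      then have "v 1 + cnj z * v N = 0" using v by (simp add: vsp_def)
      then show ?thesis by (intro qform_diag_mono) (simp_all only:, simp_all)
    next
      case False
      then have "?c a1 \<le> ?c a2" using a by (intro divide_left_mono mult_pos_pos) auto
      then show ?thesis by (rule mono)
    qed
  next
    show "vsp N z (a2 = 1 / f 0) False \<subseteq> vsp N z (a1 = 1 / f 0) False"
      using ne by (auto intro: vsp_transfer)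
  qed (use n ne in \<open>auto simp: dim_vsp[OF hN] split: if_splits\<close>)
  show "eig f q w N (bcA a2 b z) n \<le> eig f q w N (bcA a3 b z) (n + 1)" if n: "n < N - 1"
  proof (rule eig_interlace[OF A A linear_constraint])
    fix v :: "nat \<Rightarrow> complex" assume v: "v \<in> vsp N z (a3 = 1 / f 0) False" "v 1 + cnj z * v N = 0"
    show "v \<in> vsp N z (a2 = 1 / f 0) False" using v by (auto intro: vsp_transfer)
    show "Re (qform f q N z b (?c a2) v v) \<le> Re (qform f q N z b (?c a3) v v)"
      using v(2) by (intro qform_diag_mono) (simp_all only:, simp_all)
  qed (use n ne in \<open>auto simp: dim_vsp[OF hN]\<close>)
qed

text \<open>\<open>S2\<close> is the restriction of the problem with \<open>A(a, b)\<close> to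
  \<open>v N = 0\<close>, for every \<open>b\<close>. Taking \<open>b = b2\<close> gives the bound
  from below by monotonicity, and \<open>b = b1\<close> the bound from above by interlacing. The
  number \<open>k\<close> is the dimension of the unrestricted pencil.\<close>

lemma interlacing_b21:
  fixes a :: real
  assumes b: "b1 < b2"
  defines "k \<equiv> N - of_bool (a = 1 / f 0)"
  shows "n < k \<Longrightarrow> eig f q w N (bcA a b1 z) n \<le> eig f q w N (bcA a b2 z) n"
    and "n + 1 < k \<Longrightarrow> eig f q w N (bcA a b2 z) n \<le> eig f q w N (bcS2 a) n"
    and "n + 1 < k \<Longrightarrow> eig f q w N (bcS2 a) n \<le> eig f q w N (bcA a b1 z) (n + 1)"
proof -
  note A = realization_A[where a = a] and S = realization_S2[where a = a]
  show "eig f q w N (bcA a b1 z) n \<le> eig f q w N (bcA a b2 z) n" if "n < k"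
    using that b
    by (intro eig_mono[OF A A] qform_diag_mono mult_right_mono) (auto simp: dim_vsp[OF hN] k_def)
  show "eig f q w N (bcA a b2 z) n \<le> eig f q w N (bcS2 a) n" if "n + 1 < k"
  proof (rule eig_mono[OF A S[where b = b2]])
    show "vsp N z (a = 1 / f 0) True \<subseteq> vsp N z (a = 1 / f 0) False"
      by (auto simp: vsp_def)
  qed (use that in \<open>auto simp: dim_vsp[OF hN] k_def\<close>)
  show "eig f q w N (bcS2 a) n \<le> eig f q w N (bcA a b1 z) (n + 1)" if "n + 1 < k"
  proof (rule eig_interlace[OF S[where b = b1] A linear_coordinate[of N]])
    show "v \<in> vsp N z (a = 1 / f 0) True" if "v \<in> vsp N z (a = 1 / f 0) False" "v N = 0" for v
      using that by (auto simp: vsp_def)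
  qed (use that in \<open>auto simp: dim_vsp[OF hN] k_def\<close>)
qed

lemma eigenvalue_counts:
  shows "has_exactly_eigs f q w N (bcA a b z) (N - of_bool (a = 1 / f 0))"
    and "has_exactly_eigs f q w N (bcS1 b) N"
    and "has_exactly_eigs f q w N (bcS2 a) (N - of_bool (a = 1 / f 0) - 1)"
  using sl_realization.has_exactly_eigs_dim[OF realization_A[where a = a and b = b]]
    sl_realization.has_exactly_eigs_dim[OF realization_S1[where b = b]]
    sl_realization.has_exactly_eigs_dim[OF realization_S2[where a = a]]
  by (simp_all add: dim_vsp[OF hN])

end

theorem theorem3p2:
  fixes f q w :: "nat \<Rightarrow> real" and N :: nat and z :: complex
  assumes hN: "N \<ge> 2"
    and hf: "\<forall>n\<le>N. f n \<noteq> 0"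
    and hw: "\<forall>n\<in>{1..N}. w n > 0"
  shows
    "(\<forall>a12 b21. (a12 \<noteq> 1 / f 0 \<longrightarrow> has_exactly_eigs f q w N (bcA a12 b21 z) N)
               \<and> (a12 = 1 / f 0 \<longrightarrow> has_exactly_eigs f q w N (bcA a12 b21 z) (N - 1)))
     \<and> (\<forall>b21. has_exactly_eigs f q w N (bcS1 b21) N)
     \<and> (\<forall>a12. (a12 \<noteq> 1 / f 0 \<longrightarrow> has_exactly_eigs f q w N (bcS2 a12) (N - 1))
               \<and> (a12 = 1 / f 0 \<longrightarrow> has_exactly_eigs f q w N (bcS2 a12) (N - 2)))
     \<and> (\<forall>b21 a1 a2 a3 a4. a1 < a2 \<and> a2 \<le> 1 / f 0 \<and> 1 / f 0 < a3 \<and> a3 < a4 \<longrightarrow>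
          (\<forall>n. n \<le> N - 2 \<longrightarrow>
              eig f q w N (bcA a3 b21 z) n \<le> eig f q w N (bcA a4 b21 z) n
            \<and> eig f q w N (bcA a4 b21 z) n \<le> eig f q w N (bcS1 b21) n
            \<and> eig f q w N (bcS1 b21) n \<le> eig f q w N (bcA a1 b21 z) n
            \<and> eig f q w N (bcA a1 b21 z) n \<le> eig f q w N (bcA a2 b21 z) n
            \<and> eig f q w N (bcA a2 b21 z) n \<le> eig f q w N (bcA a3 b21 z) (n + 1))
        \<and> eig f q w N (bcA a3 b21 z) (N - 1) \<le> eig f q w N (bcA a4 b21 z) (N - 1)
        \<and> eig f q w N (bcA a4 b21 z) (N - 1) \<le> eig f q w N (bcS1 b21) (N - 1)
        \<and> eig f q w N (bcS1 b21) (N - 1) \<le> eig f q w N (bcA a1 b21 z) (N - 1)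
        \<and> (a2 < 1 / f 0 \<longrightarrow>
              eig f q w N (bcA a1 b21 z) (N - 1) \<le> eig f q w N (bcA a2 b21 z) (N - 1)))
     \<and> (\<forall>a12 b1 b2. b1 < b2 \<longrightarrow>
          (\<forall>n. n + 3 \<le> N \<longrightarrow>
              eig f q w N (bcA a12 b1 z) n \<le> eig f q w N (bcA a12 b2 z) n
            \<and> eig f q w N (bcA a12 b2 z) n \<le> eig f q w N (bcS2 a12) n
            \<and> eig f q w N (bcS2 a12) n \<le> eig f q w N (bcA a12 b1 z) (n + 1))
        \<and> eig f q w N (bcA a12 b1 z) (N - 2) \<le> eig f q w N (bcA a12 b2 z) (N - 2)
        \<and> (a12 \<noteq> 1 / f 0 \<longrightarrow>
              eig f q w N (bcA a12 b2 z) (N - 2) \<le> eig f q w N (bcS2 a12) (N - 2)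
            \<and> eig f q w N (bcS2 a12) (N - 2) \<le> eig f q w N (bcA a12 b1 z) (N - 1)
            \<and> eig f q w N (bcA a12 b1 z) (N - 1) \<le> eig f q w N (bcA a12 b2 z) (N - 1)))"
proof -
  note counts = eigenvalue_counts[OF assms] and ia = interlacing_a12[OF assms]
    and ib = interlacing_b21[OF assms]
  show ?thesis
  proof (intro conjI allI impI; (elim conjE)?)
    show "has_exactly_eigs f q w N (bcA a12 b21 z) N" if "a12 \<noteq> 1 / f 0" for a12 b21
      using counts(1)[of q a12 b21 z] that by simp
    show "has_exactly_eigs f q w N (bcA a12 b21 z) (N - 1)" if "a12 = 1 / f 0" for a12 b21
      using counts(1)[of q a12 b21 z] that by simp
    show "has_exactly_eigs f q w N (bcS1 b21) N" for b21
      by (rule counts(2))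
    show "has_exactly_eigs f q w N (bcS2 a12) (N - 1)" if "a12 \<noteq> 1 / f 0" for a12
      using counts(3)[of q a12] that by simp
    show "has_exactly_eigs f q w N (bcS2 a12) (N - 2)" if "a12 = 1 / f 0" for a12
      using counts(3)[of q a12] that by (simp add: numeral_2_eq_2)
  next
    fix b21 a1 a2 a3 a4 n
    assume a: "a1 < a2" "a2 \<le> 1 / f 0" "1 / f 0 < a3" "a3 < a4"
    note ia = ia[OF a]
    show "eig f q w N (bcA a3 b21 z) (N - 1) \<le> eig f q w N (bcA a4 b21 z) (N - 1)"
      "eig f q w N (bcA a4 b21 z) (N - 1) \<le> eig f q w N (bcS1 b21) (N - 1)"
      "eig f q w N (bcS1 b21) (N - 1) \<le> eig f q w N (bcA a1 b21 z) (N - 1)"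
      using hN by (auto intro: ia)
    show "eig f q w N (bcA a1 b21 z) (N - 1) \<le> eig f q w N (bcA a2 b21 z) (N - 1)" if "a2 < 1 / f 0"
      using hN that by (intro ia) auto
    assume n: "n \<le> N - 2"
    then show "eig f q w N (bcA a3 b21 z) n \<le> eig f q w N (bcA a4 b21 z) n"
      "eig f q w N (bcA a4 b21 z) n \<le> eig f q w N (bcS1 b21) n"
      "eig f q w N (bcS1 b21) n \<le> eig f q w N (bcA a1 b21 z) n"
      using hN by (auto intro: ia)
    \<comment> \<open>For \<open>a2 = 1 / f 0\<close> only \<open>N - 1\<close> eigenvalues exist,
      and \<open>n\<close> at most \<open>N - 2\<close> still stays below that number.\<close>
    show "eig f q w N (bcA a1 b21 z) n \<le> eig f q w N (bcA a2 b21 z) n"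
      "eig f q w N (bcA a2 b21 z) n \<le> eig f q w N (bcA a3 b21 z) (n + 1)"
      using hN n by (intro ia; auto)+
  next
    fix a12 b1 b2 :: real and n
    assume b: "b1 < b2"
    note ib = ib[OF b]
    \<comment> \<open>The index \<open>N - 2\<close> is valid even when
      \<open>a12 = 1 / f 0\<close>, where it is the last one.\<close>
    show "eig f q w N (bcA a12 b1 z) (N - 2) \<le> eig f q w N (bcA a12 b2 z) (N - 2)"
      using hN by (intro ib) auto
    show "eig f q w N (bcA a12 b1 z) n \<le> eig f q w N (bcA a12 b2 z) n"
      "eig f q w N (bcA a12 b2 z) n \<le> eig f q w N (bcS2 a12) n"
      "eig f q w N (bcS2 a12) n \<le> eig f q w N (bcA a12 b1 z) (n + 1)" if "n + 3 \<le> N"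
      using that by (intro ib; auto)+
    assume a: "a12 \<noteq> 1 / f 0"
    show "eig f q w N (bcA a12 b2 z) (N - 2) \<le> eig f q w N (bcS2 a12) (N - 2)"
      using hN a by (intro ib) simp
    have "eig f q w N (bcS2 a12) (N - 2) \<le> eig f q w N (bcA a12 b1 z) (N - 2 + 1)"
      using hN a by (intro ib) simp
    moreover have "N - 2 + 1 = N - 1" using hN by simp
    ultimately show "eig f q w N (bcS2 a12) (N - 2) \<le> eig f q w N (bcA a12 b1 z) (N - 1)" by simp
    show "eig f q w N (bcA a12 b1 z) (N - 1) \<le> eig f q w N (bcA a12 b2 z) (N - 1)"
      using hN a by (intro ib) simp
  qed
qed

end
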